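(* Consider any lattice Boltzmann scheme, with $N\in\{1,\dots,q-1\}$ conserved moments, as described in the context, and assume that its relaxation matrix is invertible, $S\in\mathrm{GL}_q(\mathbb R)$ (so that $\det(\zeta I-\mathcal A)$ is a unit of $\mathcal S$, equivalently $\zeta I-\mathcal A\in\mathrm{GL}_q(\mathcal S)$). Then the modified equations obtained by the Maxwell iteration on the lattice Boltzmann scheme and those obtained from the corresponding Finite Difference schemes are the same at any order, regardless of the scaling between time and space discretizations. More precisely, when $N=1$ (the case in which the demonstration is carried out), the formal expansion of the scheme satisfies $$\begin{aligned}0&=\det(\zeta I-\mathcal A)\,m-\mathrm{adj}(\zeta I-\mathcal A)\,\mathcal B\,m^{\mathrm{eq}}=\det(\zeta I-\mathcal A)\Big(m-\big(\zeta I-\mathcal T(I-S)\big)^{-1}\mathcal T S\,m^{\mathrm{eq}}\Big)\\&=\det(\zeta I-\mathcal A)\Big(m-\big(S^{-1}\overline{\mathcal T}(\zeta I-\mathcal T(I-S))\big)^{-1}m^{\mathrm{eq}}\Big)=\det(\zeta I-\mathcal A)\Big(m-\big(I+S^{-1}(\zeta\overline{\mathcal T}-I)\big)^{-1}m^{\mathrm{eq}}\Big)\\&=\det(\zeta I-\mathcal A)\Big(m-\Big(\sum_{r=0}^{+\infty}\big(-S^{-1}(\zeta\overline{\mathcal T}-I)\big)^r\Big)m^{\mathrm{eq}}\Big)=\det(\zeta I-\mathcal A)\Big(m-\lim_{k\to+\infty}m^{[k]}\Big).\end{aligned}$$ Therefore the expansion of the corresponding Finite Difference scheme and the non-truncated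 Maxwell iteration on the lattice Boltzmann scheme coincide up to multiplication by a formal power series of time-space differential operators, namely $\det(\zeta I-\mathcal A)\in\mathcal S$. Since $\det(\zeta I-\mathcal A)=\det(S)+O(\Delta x)=s_1\Pi+O(\Delta x)$ with $\Pi=\prod_{i=2}^q s_i$, this factor is at dominant order only a constant by which one can divide, so that the modified equations at leading order are the same; and then they are the same at each order, because in both cases the result truncated at the previous order is recursively re-injected to eliminate the higher-order time derivatives.
   Context: Lattice Boltzmann scheme. Let $d\in\{1,2,3\}$, let $\Delta x,\Delta t>0$ be the space and time steps, $c_1,\dots,c_q\in\mathbb Z^d$ the normalized discrete velocities, $M\in\mathrm{GL}_q(\mathbb R)$ the moment matrix and $S=\mathrm{diag}(s_1,\dots,s_q)$ the relaxation matrix, with $s_i\in\mathbb R$ for $i\le N$ (conserved moments) and $s_i\in(0,2]$ for $i\ge N+1$ (non-conserved moments); $M$ and $S$ are fixed as $\Delta x\to0$. The moments are $m=(m_1,\dots,m_q)^{\intercal}$, of which $m_1,\dots,m_N$ are conserved; the equilibria $m^{\mathrm{eq}}=m^{\mathrm{eq}}(m_1,\dots,m_N)\in\mathbb R^q$ are possibly non-linear functions with $m_i^{\mathrm{eq}}(m_1,\dots,m_N)=m_i$ for $i\le N$. With the space shifts $(\mathsf t_zf)(x)=f(x-z\Delta x)$, $z\in\mathbb Z^d$, put $\mathsf T=M\,\mathrm{diag}(\mathsf t_{c_1},\dots,\mathsf t_{c_q})M^{-1}$, $\mathsf A=\mathsf T(I-S)$, $\mathsf B=\mathsf TS$. The scheme,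 on the unbounded lattice $\Delta x\,\mathbb Z^d$, is $m(t+\Delta t,x)=\mathsf A\,m(t,x)+\mathsf B\,m^{\mathrm{eq}}(t,x)$, i.e. $(\mathsf zI-\mathsf A)m=\mathsf Bm^{\mathrm{eq}}$ with the time shift $(\mathsf zf)(t)=f(t+\Delta t)$. Corresponding Finite Difference schemes. For $i\in\{1,\dots,N\}$ let $\mathsf A_i$ be the matrix obtained from $\mathsf A$ by keeping only the entries with both row and column indices in $\{i\}\cup\{N+1,\dots,q\}$ and setting the others to zero, and $\mathsf A_i^{\diamond}=\mathsf A-\mathsf A_i$. The corresponding Finite Difference schemes on the conserved moments are $$\det(\mathsf zI-\mathsf A_i)\,m_i=\big(\mathrm{adj}(\mathsf zI-\mathsf A_i)\,\mathsf A_i^{\diamond}\,m\big)_i+\big(\mathrm{adj}(\mathsf zI-\mathsf A_i)\,\mathsf B\,m^{\mathrm{eq}}\big)_i,\qquad i=1,\dots,N,$$ where $\mathrm{adj}$ is the adjugate; for $N=1$ this is $\det(\mathsf zI-\mathsf A)m_1=(\mathrm{adj}(\mathsf zI-\mathsf A)\mathsf Bm^{\mathrm{eq}})_1$. Asymptotic equivalents. Let $\mathcal D=\mathbb R[\partial_t,\partial_{x_1},\dots,\partial_{x_d}]$ and $\mathcal S=\mathcal D[[\Delta x]]$, the ring of formal power series in $\Delta x$. The step $\Delta t$ is linked to $\Delta x$ (the scaling) as $\Delta x\to0$. A discrete operator is asymptotically equivalent to an element of $\mathcal S$ if its action on smooth functions of $(t,x)$ is given, as $\Delta x\to0$, by that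 series (Taylor expansion). Let $\zeta\in\mathcal S$ be the asymptotic equivalent of $\mathsf z$ (the Taylor series $\sum_{r\ge0}\frac{(\Delta t)^r}{r!}\partial_t^r$, with $\Delta t$ expressed through $\Delta x$ by the scaling), and $$\mathcal T=M\Big(\sum_{|\nu|\ge0}\frac{(-\Delta x)^{|\nu|}}{\nu!}\mathrm{diag}(c_1^\nu,\dots,c_q^\nu)\,\partial^\nu\Big)M^{-1},\qquad\overline{\mathcal T}=M\Big(\sum_{|\nu|\ge0}\frac{(\Delta x)^{|\nu|}}{\nu!}\mathrm{diag}(c_1^\nu,\dots,c_q^\nu)\,\partial^\nu\Big)M^{-1}$$ (with $\nu\in\mathbb N^d$ multi-indices in space), which satisfy $\mathcal T\overline{\mathcal T}=\overline{\mathcal T}\mathcal T=I$; put $\mathcal A=\mathcal T(I-S)$ and $\mathcal B=\mathcal TS$. $O(\Delta x^p)$ denotes terms of order at least $p$ in $\Delta x$. Maxwell iteration. At step $k\in\mathbb N$, $$m^{[k]}=\Big(\sum_{r=0}^{k}\big(-S^{-1}(\zeta\overline{\mathcal T}-I)\big)^r\Big)m^{\mathrm{eq}},\qquad m^{[0]}=m^{\mathrm{eq}},$$ and the method works by assuming $m=m^{[k]}+O(\Delta x^{k+1})$. Modified equations. They are formal equations on the conserved moments, obtained by applying to smooth functions either the Finite Difference schemes with each discrete operator replaced by its asymptotic equivalent, or the rows $i=1,\dots,N$ of $m=m^{[k]}+O(\Delta x^{k+1})$ (where $m^{\mathrm{eq}}_i=m_i$); truncating at the desired order in $\Delta x$;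 dividing by the constant factor at dominant order; and recursively using the equations obtained at the previous orders (differentiated formally, assuming that differentiation preserves the $O(\cdot)$ relations) to eliminate the time derivatives in the higher-order terms. *)

theory Defs
  imports
    "HOL-Analysis.Analysis"
    "HOL-Computational_Algebra.Formal_Power_Series"
    "HOL-Library.Poly_Mapping"
    "HOL-Library.Function_Algebras"
    "Jordan_Normal_Form.Determinant"
begin

unbundle no vec_syntax
hide_const (open) Determinants.det Finite_Cartesian_Product.mat Finite_Cartesian_Product.vec

section \<open>Smooth functions of time and space\<close>

text \<open>A coordinate is \<^term>\<open>None\<close> (time) or \<^term>\<open>Some i\<close> (the space coordinate \<open>i\<close>).\<close>

definition coord_dir :: "'d::finite option \<Rightarrow> real \<times> (real ^ 'd)" where
  "coord_dir i = (case i of None \<Rightarrow> (1, 0) | Some k \<Rightarrow> (0, axis k 1))"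

definition partial :: "'d::finite option \<Rightarrow> (real \<times> (real ^ 'd) \<Rightarrow> real) \<Rightarrow> real \<times> (real ^ 'd) \<Rightarrow> real" where
  "partial i f = (\<lambda>p. frechet_derivative f (at p) (coord_dir i))"

primrec C_k :: "nat \<Rightarrow> (real \<times> (real ^ 'd::finite) \<Rightarrow> real) \<Rightarrow> bool" where
  "C_k 0 f \<longleftrightarrow> continuous_on UNIV f"
| "C_k (Suc k) f \<longleftrightarrow> (\<forall>p. f differentiable (at p)) \<and> (\<forall>i. C_k k (partial i f))"

definition smooth :: "(real \<times> (real ^ 'd::finite) \<Rightarrow> real) \<Rightarrow> bool" where
  "smooth f \<longleftrightarrow> (\<forall>k. C_k k f)"

lemma differentiable_imp_continuous_UNIV:
  fixes f :: "real \<times> (real ^ 'd::finite) \<Rightarrow> real"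
  shows "(\<And>p. f differentiable (at p)) \<Longrightarrow> continuous_on UNIV f"
  by (simp add: continuous_at_imp_continuous_on differentiable_imp_continuous_within)

lemma C_k_continuous: "C_k k f \<Longrightarrow> continuous_on UNIV f"
  by (cases k) (auto intro: differentiable_imp_continuous_UNIV)

lemma C_k_Suc: "C_k (Suc k) f \<Longrightarrow> C_k k f"
proof (induction k arbitrary: f)
  case 0
  then show ?case by (metis C_k_continuous C_k.simps(1))
next
  case (Suc k)
  then show ?case by (metis C_k.simps(2))
qed

lemma partial_const: "partial i (\<lambda>_. c) = (\<lambda>_. 0)"
  by (simp add: partial_def)

lemma partial_add:
  assumes "\<And>p. f differentiable (at p)" "\<And>p. g differentiable (at p)"
  shows "partial i (\<lambda>p. f p + g p) = (\<lambda>p. partial i f p + partial i g p)"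
proof
  fix p
  have D: "((\<lambda>p. f p + g p) has_derivative
      (\<lambda>h. frechet_derivative f (at p) h + frechet_derivative g (at p) h)) (at p)"
    using assms by (intro has_derivative_add) (simp_all add: frechet_derivative_works[symmetric])
  show "partial i (\<lambda>p. f p + g p) p = partial i f p + partial i g p"
    unfolding partial_def frechet_derivative_at[OF D, symmetric] by (rule refl)
qed

lemma partial_mult:
  assumes "\<And>p. f differentiable (at p)" "\<And>p. g differentiable (at p)"
  shows "partial i (\<lambda>p. f p * g p) = (\<lambda>p. f p * partial i g p + partial i f p * g p)"
proof
  fix p
  have D: "((\<lambda>p. f p * g p) has_derivative
      (\<lambda>h. f p * frechet_derivative g (at p) h + frechet_derivative f (at p) h * g p)) (at p)"
    using assms by (intro has_derivative_mult) (simp_all add: frechet_derivative_works[symmetric])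
  show "partial i (\<lambda>p. f p * g p) p = f p * partial i g p + partial i f p * g p"
    unfolding partial_def frechet_derivative_at[OF D, symmetric] by (rule refl)
qed

lemma C_k_const: "C_k k (\<lambda>_. c)"
  by (induction k arbitrary: c) (auto simp: partial_const)

lemma C_k_add: "C_k k f \<Longrightarrow> C_k k g \<Longrightarrow> C_k k (\<lambda>p. f p + g p)"
proof (induction k arbitrary: f g)
  case 0
  then show ?case by (auto intro: continuous_on_add)
next
  case (Suc k)
  then have "partial i (\<lambda>p. f p + g p) = (\<lambda>p. partial i f p + partial i g p)" for i
    by (intro partial_add) auto
  with Suc show ?case by auto
qed

lemma C_k_mult: "C_k k f \<Longrightarrow> C_k k g \<Longrightarrow> C_k k (\<lambda>p. f p * g p)"
proof (induction k arbitrary: f g)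
  case 0
  then show ?case by (auto intro: continuous_on_mult)
next
  case (Suc k)
  then have "partial i (\<lambda>p. f p * g p) = (\<lambda>p. f p * partial i g p + partial i f p * g p)" for i
    by (intro partial_mult) auto
  moreover have "C_k k f" "C_k k g"
    using Suc.prems C_k_Suc by blast+
  ultimately show ?case
    using Suc by (auto intro!: C_k_add)
qed

lemma smooth_const: "smooth (\<lambda>_. c)"
  and smooth_add: "smooth f \<Longrightarrow> smooth g \<Longrightarrow> smooth (\<lambda>p. f p + g p)"
  and smooth_mult: "smooth f \<Longrightarrow> smooth g \<Longrightarrow> smooth (\<lambda>p. f p * g p)"
  by (auto simp: smooth_def C_k_const C_k_add C_k_mult)

lemma smooth_uminus: "smooth f \<Longrightarrow> smooth (\<lambda>p. - f p)"
  using smooth_mult[OF smooth_const[of "-1"], of f] by simp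

lemma smooth_partial: "smooth f \<Longrightarrow> smooth (partial i f)"
  unfolding smooth_def by (metis C_k.simps(2))

lemma smooth_differentiable: "smooth f \<Longrightarrow> f differentiable (at p)"
  unfolding smooth_def by (metis C_k.simps(2))

typedef (overloaded) 'd sfield = "{f :: real \<times> (real ^ 'd::finite) \<Rightarrow> real. smooth f}"
  by (auto intro: smooth_const)

setup_lifting type_definition_sfield

instantiation sfield :: (finite) comm_ring_1
begin
lift_definition zero_sfield :: "'a sfield" is "\<lambda>_. 0" by (rule smooth_const)
lift_definition one_sfield :: "'a sfield" is "\<lambda>_. 1" by (rule smooth_const)
lift_definition plus_sfield :: "'a sfield \<Rightarrow> 'a sfield \<Rightarrow> 'a sfield" is "\<lambda>f g p. f p + g p"
  by (rule smooth_add)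
lift_definition times_sfield :: "'a sfield \<Rightarrow> 'a sfield \<Rightarrow> 'a sfield" is "\<lambda>f g p. f p * g p"
  by (rule smooth_mult)
lift_definition uminus_sfield :: "'a sfield \<Rightarrow> 'a sfield" is "\<lambda>f p. - f p"
  by (rule smooth_uminus)
lift_definition minus_sfield :: "'a sfield \<Rightarrow> 'a sfield \<Rightarrow> 'a sfield" is "\<lambda>f g p. f p - g p"
  using smooth_add smooth_uminus by fastforce
instance by standard (transfer; simp add: algebra_simps fun_eq_iff)+
end

instantiation sfield :: (finite) real_algebra_1
begin
lift_definition scaleR_sfield :: "real \<Rightarrow> 'a sfield \<Rightarrow> 'a sfield" is "\<lambda>c f p. c * f p"
  using smooth_mult smooth_const by blast
instance by standard (transfer; simp add: algebra_simps)+
end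

lift_definition pd :: "'d::finite option \<Rightarrow> 'd sfield \<Rightarrow> 'd sfield" is partial
  by (rule smooth_partial)

text \<open>The derivatives commute, so that \<open>deriv_mono\<close> does not depend on the order of the
  differentiations.\<close>

lemma partial_line:
  assumes "\<And>p. f differentiable (at p)"
  shows "((\<lambda>s. f (p + s *\<^sub>R coord_dir i)) has_real_derivative
          partial i f (p + s *\<^sub>R coord_dir i)) (at s)"
proof -
  let ?q = "p + s *\<^sub>R coord_dir i"
  have 1: "(f has_derivative frechet_derivative f (at ?q)) (at ?q)"
    using assms frechet_derivative_works by blast
  have 2: "((\<lambda>s. p + s *\<^sub>R coord_dir i) has_derivative (\<lambda>h. h *\<^sub>R coord_dir i)) (at s)"
    by (auto intro!: derivative_eq_intros)
  have 3: "((\<lambda>s. f (p + s *\<^sub>R coord_dir i)) has_derivative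
      (\<lambda>h. frechet_derivative f (at ?q) (h *\<^sub>R coord_dir i))) (at s)"
    using has_derivative_compose[OF 2 1] by simp
  have "linear (frechet_derivative f (at ?q))"
    using assms linear_frechet_derivative by blast
  then have "(\<lambda>h. frechet_derivative f (at ?q) (h *\<^sub>R coord_dir i)) = (*) (partial i f ?q)"
    by (auto simp: partial_def linear_cmul mult.commute)
  with 3 show ?thesis by (simp add: has_field_derivative_def)
qed

lemma partial_second_difference:
  assumes "smooth f" and "h > 0"
  shows "\<exists>a b. 0 < a \<and> a < h \<and> 0 < b \<and> b < h \<and>
      f (p + h *\<^sub>R coord_dir i + h *\<^sub>R coord_dir j) - f (p + h *\<^sub>R coord_dir i)
        - f (p + h *\<^sub>R coord_dir j) + f p
      = h * h * partial j (partial i f) (p + a *\<^sub>R coord_dir i + b *\<^sub>R coord_dir j)"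
proof -
  let ?u = "coord_dir i" and ?v = "coord_dir j"
  define g where "g s = f ((p + h *\<^sub>R ?v) + s *\<^sub>R ?u) - f (p + s *\<^sub>R ?u)" for s
  have d: "\<And>p. f differentiable (at p)" "\<And>p. partial i f differentiable (at p)"
    using assms(1) by (auto intro: smooth_differentiable smooth_partial)
  have "(g has_real_derivative
      partial i f ((p + h *\<^sub>R ?v) + s *\<^sub>R ?u) - partial i f (p + s *\<^sub>R ?u)) (at s)" for s
    unfolding g_def by (intro DERIV_diff partial_line d)
  then obtain a where a: "0 < a" "a < h"
    "g h - g 0 = (h - 0) * (partial i f ((p + h *\<^sub>R ?v) + a *\<^sub>R ?u) - partial i f (p + a *\<^sub>R ?u))"
    using MVT2[of 0 h g "\<lambda>s. partial i f ((p + h *\<^sub>R ?v) + s *\<^sub>R ?u) - partial i f (p + s *\<^sub>R ?u)"]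
      \<open>h > 0\<close> by blast
  define k where "k s = partial i f ((p + a *\<^sub>R ?u) + s *\<^sub>R ?v)" for s
  have "(k has_real_derivative partial j (partial i f) ((p + a *\<^sub>R ?u) + s *\<^sub>R ?v)) (at s)" for s
    unfolding k_def by (intro partial_line d)
  then obtain b where b: "0 < b" "b < h"
    "k h - k 0 = (h - 0) * partial j (partial i f) ((p + a *\<^sub>R ?u) + b *\<^sub>R ?v)"
    using MVT2[of 0 h k "\<lambda>s. partial j (partial i f) ((p + a *\<^sub>R ?u) + s *\<^sub>R ?v)"]
      \<open>h > 0\<close> by blast
  have "g h - g 0 = h * (h * partial j (partial i f) (p + a *\<^sub>R ?u + b *\<^sub>R ?v))"
    using a(3) b(3) by (simp add: k_def algebra_simps)
  then show ?thesis
    using a(1,2) b(1,2) by (intro exI[of _ a] exI[of _ b]) (simp add: g_def algebra_simps)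
qed

lemma partial_commute:
  fixes f :: "real \<times> (real ^ 'd::finite) \<Rightarrow> real"
  assumes "smooth f"
  shows "partial i (partial j f) = partial j (partial i f)"
proof
  fix p
  define D where "D i j h = f (p + h *\<^sub>R coord_dir i + h *\<^sub>R coord_dir j) - f (p + h *\<^sub>R coord_dir i)
      - f (p + h *\<^sub>R coord_dir j) + f p" for i j :: "'d option" and h
  have lim: "((\<lambda>h. D i j h / (h * h)) \<longlongrightarrow> partial j (partial i f) p) (at_right 0)" for i j
  proof -
    have "\<forall>h. \<exists>a b. h > 0 \<longrightarrow> 0 < a \<and> a < h \<and> 0 < b \<and> b < h \<and>
        D i j h = h * h * partial j (partial i f) (p + a *\<^sub>R coord_dir i + b *\<^sub>R coord_dir j)"
      unfolding D_def using partial_second_difference[OF assms] by blast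
    then obtain a b where ab: "\<And>h. h > 0 \<Longrightarrow> 0 < a h \<and> a h < h \<and> 0 < b h \<and> b h < h \<and>
        D i j h = h * h * partial j (partial i f) (p + a h *\<^sub>R coord_dir i + b h *\<^sub>R coord_dir j)"
      by metis
    have e: "eventually (\<lambda>h::real. h > 0) (at_right 0)"
      by (simp add: eventually_at_right_less)
    have id0: "((\<lambda>h::real. h) \<longlongrightarrow> 0) (at_right 0)"
      by (rule tendsto_ident_at)
    have a0: "(a \<longlongrightarrow> 0) (at_right 0)"
      by (rule tendsto_sandwich[OF _ _ tendsto_const id0]) (use e ab in \<open>auto elim!: eventually_mono intro: less_imp_le\<close>)
    have b0: "(b \<longlongrightarrow> 0) (at_right 0)"
      by (rule tendsto_sandwich[OF _ _ tendsto_const id0]) (use e ab in \<open>auto elim!: eventually_mono intro: less_imp_le\<close>)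
    have "((\<lambda>h. p + a h *\<^sub>R coord_dir i + b h *\<^sub>R coord_dir j) \<longlongrightarrow>
        p + 0 *\<^sub>R coord_dir i + 0 *\<^sub>R coord_dir j) (at_right 0)"
      by (intro tendsto_intros a0 b0)
    then have q: "((\<lambda>h. p + a h *\<^sub>R coord_dir i + b h *\<^sub>R coord_dir j) \<longlongrightarrow> p) (at_right 0)"
      by simp
    have "isCont (partial j (partial i f)) p"
      using assms by (metis differentiable_imp_continuous_within smooth_differentiable smooth_partial)
    from isCont_tendsto_compose[OF this q]
    show ?thesis
    proof (rule Lim_transform_eventually)
      show "\<forall>\<^sub>F h in at_right 0. partial j (partial i f) (p + a h *\<^sub>R coord_dir i + b h *\<^sub>R coord_dir j)
          = D i j h / (h * h)"
      proof (rule eventually_mono[OF e])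
        fix h :: real
        assume "0 < h"
        with ab[OF this]
        show "partial j (partial i f) (p + a h *\<^sub>R coord_dir i + b h *\<^sub>R coord_dir j) = D i j h / (h * h)"
          by simp
      qed
    qed
  qed
  have "D i j = D j i"
    by (auto simp: D_def fun_eq_iff algebra_simps)
  with lim[of j i]
  have "((\<lambda>h. D i j h / (h * h)) \<longlongrightarrow> partial i (partial j f) p) (at_right 0)"
    by simp
  then show "partial i (partial j f) p = partial j (partial i f) p"
    by (rule tendsto_unique[OF trivial_limit_at_right_real _ lim])
qed

lemma pd_commute: "pd i (pd j f) = pd j (pd i f)"
  by transfer (rule partial_commute)

section \<open>Discrete operators and formal series of differential operators\<close>

text \<open>
  Discrete operators: the commutative algebra generated by the time shift and the space shifts,
  i.e. the monoid algebra of pairs (power of the time shift, space shift).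
  Differential operators: polynomials in the time derivative and the space derivatives, the
  exponent \<open>(n, \<nu>)\<close> standing for \<open>n\<close> time derivatives and the space multi-index \<open>\<nu>\<close>.
  Formal series are in the variable \<open>\<Delta>x\<close>.
\<close>

type_synonym 'd disc_op = "(nat \<times> (int ^ 'd)) \<Rightarrow>\<^sub>0 real"
type_synonym 'd diff_op = "(nat \<times> (nat ^ 'd)) \<Rightarrow>\<^sub>0 real"
type_synonym 'd series = "'d diff_op fps"

definition const_op :: "real \<Rightarrow> 'k::comm_monoid_add \<Rightarrow>\<^sub>0 real" where
  "const_op c = Poly_Mapping.single 0 c"

definition const_series :: "real \<Rightarrow> 'd::finite series" where
  "const_series c = fps_const (const_op c)"

definition time_shift :: "'d::finite disc_op" where
  "time_shift = Poly_Mapping.single (1, 0) 1"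

definition space_shift :: "int ^ 'd::finite \<Rightarrow> 'd disc_op" where
  "space_shift z = Poly_Mapping.single (0, z) 1"

text \<open>A scaling expresses \<open>\<Delta>t\<close> as a formal power series \<open>\<tau>\<close> in \<open>\<Delta>x\<close> which vanishes with \<open>\<Delta>x\<close>
  and is positive for small \<open>\<Delta>x > 0\<close>: acoustic \<open>\<Delta>x / \<lambda>\<close>, diffusive \<open>\<Delta>x\<^sup>2 / \<mu>\<close>, and so on.\<close>

definition scaling :: "real fps \<Rightarrow> bool" where
  "scaling \<tau> \<longleftrightarrow> fps_nth \<tau> 0 = 0 \<and> fps_nth \<tau> (subdegree \<tau>) > 0"

text \<open>The series \<open>\<Sum>r. (\<Delta>t)\<^sup>r / r! \<partial>\<^sub>t\<^sup>r\<close> with \<open>\<Delta>t = \<tau>\<close>. As \<open>\<tau>\<close> has no constant term, only \<open>r \<le> n\<close>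
  contributes to the coefficient of \<open>(\<Delta>x)\<^sup>n\<close>.\<close>

definition zeta :: "real fps \<Rightarrow> 'd::finite series" where
  "zeta \<tau> = Abs_fps (\<lambda>n. \<Sum>r\<le>n. Poly_Mapping.single (r, 0) (fps_nth (\<tau> ^ r) n / fact r))"

text \<open>The series \<open>\<Sum>\<nu>. (\<sigma> \<Delta>x)\<^bsup>|\<nu>|\<^esup> / \<nu>! z\<^sup>\<nu> \<partial>\<^sup>\<nu>\<close>: for \<open>\<sigma> = -1\<close> the asymptotic equivalent of
  the shift \<open>f \<mapsto> f (x - z \<Delta>x)\<close>, for \<open>\<sigma> = 1\<close> that of its inverse.\<close>

definition shift_series :: "real \<Rightarrow> int ^ 'd::finite \<Rightarrow> 'd series" where
  "shift_series \<sigma> z = Abs_fps (\<lambda>n. \<Sum>\<nu> | (\<Sum>i\<in>UNIV. vec_nth \<nu> i) = n.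
     Poly_Mapping.single (0, \<nu>)
       (\<sigma> ^ n * (\<Prod>i\<in>UNIV. real_of_int (vec_nth z i) ^ vec_nth \<nu> i / fact (vec_nth \<nu> i))))"

text \<open>Replacement of each discrete operator by its asymptotic equivalent.\<close>

definition asym :: "real fps \<Rightarrow> 'd::finite disc_op \<Rightarrow> 'd series" where
  "asym \<tau> P = (\<Sum>k\<in>Poly_Mapping.keys P.
     const_series (Poly_Mapping.lookup P k) * zeta \<tau> ^ fst k * shift_series (-1) (snd k))"

section \<open>Lattice Boltzmann schemes\<close>

text \<open>Indices are shifted by one: moments and velocities are numbered \<open>0, ..., q - 1\<close>, the
  conserved moments being \<open>0, ..., N - 1\<close>.\<close>

record ('d::finite) lbm =
  nmom :: nat  (* q *)
  ncons :: nat  (* N *)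
  vel :: "nat \<Rightarrow> int ^ 'd"
  mom_mat :: "real mat"
  relax :: "nat \<Rightarrow> real"
  equil :: "real vec \<Rightarrow> real vec"

definition relax_mat :: "'d::finite lbm \<Rightarrow> real mat" where
  "relax_mat L = mat_diag (nmom L) (relax L)"

text \<open>Functions of the conserved moments which turn smooth conserved moments into a smooth
  function; this is what is needed to expand them by Taylor's formula.\<close>

definition smooth_of_moments :: "'d::finite itself \<Rightarrow> nat \<Rightarrow> (real vec \<Rightarrow> real) \<Rightarrow> bool" where
  "smooth_of_moments _ N g \<longleftrightarrow> (\<forall>m :: nat \<Rightarrow> real \<times> (real ^ 'd) \<Rightarrow> real.
     (\<forall>i<N. smooth (m i)) \<longrightarrow> smooth (\<lambda>p. g (vec N (\<lambda>i. m i p))))"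

definition lattice_boltzmann :: "'d::finite lbm \<Rightarrow> bool" where
  "lattice_boltzmann L \<longleftrightarrow>
     CARD('d) \<in> {1, 2, 3} \<and>
     1 \<le> ncons L \<and> ncons L \<le> nmom L - 1 \<and>
     mom_mat L \<in> carrier_mat (nmom L) (nmom L) \<and> invertible_mat (mom_mat L) \<and>
     (\<forall>i. ncons L \<le> i \<and> i < nmom L \<longrightarrow> 0 < relax L i \<and> relax L i \<le> 2) \<and>
     equil L \<in> carrier_vec (ncons L) \<rightarrow> carrier_vec (nmom L) \<and>
     (\<forall>u\<in>carrier_vec (ncons L). \<forall>i<ncons L. equil L u $ i = u $ i) \<and>
     (\<forall>j<nmom L. smooth_of_moments TYPE('d) (ncons L) (\<lambda>u. equil L u $ j))"

definition mat_inv :: "'r::comm_ring_1 mat \<Rightarrow> 'r mat" where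
  "mat_inv A = (THE B. B \<in> carrier_mat (dim_row A) (dim_row A) \<and> inverts_mat A B \<and> inverts_mat B A)"

text \<open>\<open>M diag(f\<^sub>1, ..., f\<^sub>q) M\<^sup>-\<^sup>1\<close> over a ring into which the reals are embedded by \<open>e\<close>.\<close>

definition conj_diag :: "(real \<Rightarrow> 'r::comm_ring_1) \<Rightarrow> 'd::finite lbm \<Rightarrow> (nat \<Rightarrow> 'r) \<Rightarrow> 'r mat" where
  "conj_diag e L f = map_mat e (mom_mat L) * mat_diag (nmom L) f * map_mat e (mat_inv (mom_mat L))"

subsection \<open>Discrete operators and corresponding Finite Difference schemes\<close>

definition disc_T :: "'d::finite lbm \<Rightarrow> 'd disc_op mat" where
  "disc_T L = conj_diag const_op L (\<lambda>j. space_shift (vel L j))"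

definition disc_A :: "'d::finite lbm \<Rightarrow> 'd disc_op mat" where
  "disc_A L = disc_T L * (1\<^sub>m (nmom L) - map_mat const_op (relax_mat L))"

definition disc_B :: "'d::finite lbm \<Rightarrow> 'd disc_op mat" where
  "disc_B L = disc_T L * map_mat const_op (relax_mat L)"

definition disc_A_keep :: "'d::finite lbm \<Rightarrow> nat \<Rightarrow> 'd disc_op mat" where
  "disc_A_keep L i = (let K = {i} \<union> {ncons L..<nmom L} in
     mat (nmom L) (nmom L) (\<lambda>(k, l). if k \<in> K \<and> l \<in> K then disc_A L $$ (k, l) else 0))"

definition disc_A_diamond :: "'d::finite lbm \<Rightarrow> nat \<Rightarrow> 'd disc_op mat" where
  "disc_A_diamond L i = disc_A L - disc_A_keep L i"

definition fd_mat :: "'d::finite lbm \<Rightarrow> nat \<Rightarrow> 'd disc_op mat" where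
  "fd_mat L i = time_shift \<cdot>\<^sub>m 1\<^sub>m (nmom L) - disc_A_keep L i"

subsection \<open>Asymptotic equivalents of the matrices of the scheme\<close>

definition ser_T :: "'d::finite lbm \<Rightarrow> 'd series mat" where
  "ser_T L = conj_diag const_series L (\<lambda>j. shift_series (-1) (vel L j))"

definition ser_Tbar :: "'d::finite lbm \<Rightarrow> 'd series mat" where
  "ser_Tbar L = conj_diag const_series L (\<lambda>j. shift_series 1 (vel L j))"

definition ser_S :: "'d::finite lbm \<Rightarrow> 'd series mat" where
  "ser_S L = map_mat const_series (relax_mat L)"

definition ser_S_inv :: "'d::finite lbm \<Rightarrow> 'd series mat" where
  "ser_S_inv L = map_mat const_series (mat_inv (relax_mat L))"

definition ser_A :: "'d::finite lbm \<Rightarrow> 'd series mat" where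
  "ser_A L = ser_T L * (1\<^sub>m (nmom L) - ser_S L)"

definition ser_B :: "'d::finite lbm \<Rightarrow> 'd series mat" where
  "ser_B L = ser_T L * ser_S L"

definition zetaI :: "'d::finite lbm \<Rightarrow> real fps \<Rightarrow> 'd series mat" where
  "zetaI L \<tau> = zeta \<tau> \<cdot>\<^sub>m 1\<^sub>m (nmom L)"

definition char_mat :: "'d::finite lbm \<Rightarrow> real fps \<Rightarrow> 'd series mat" where
  "char_mat L \<tau> = zetaI L \<tau> - ser_A L"

text \<open>The matrix \<open>S\<^sup>-\<^sup>1 (\<zeta> T\<^sup>- - I)\<close>, where \<open>T\<^sup>-\<close> is \<open>ser_Tbar\<close>.\<close>

definition maxwell_mat :: "'d::finite lbm \<Rightarrow> real fps \<Rightarrow> 'd series mat" where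
  "maxwell_mat L \<tau> = ser_S_inv L * (zeta \<tau> \<cdot>\<^sub>m ser_Tbar L - 1\<^sub>m (nmom L))"

section \<open>Formal expressions in the moments\<close>

text \<open>An expression maps a tuple of smooth moments to a smooth function of time and space.
  Addition and multiplication of expressions are pointwise.\<close>

type_synonym 'd expr = "(nat \<Rightarrow> 'd sfield) \<Rightarrow> 'd sfield"

definition deriv_mono :: "nat \<times> (nat ^ 'd) \<Rightarrow> 'd::finite sfield \<Rightarrow> 'd sfield" where
  "deriv_mono k f = (pd None ^^ fst k)
     (Finite_Set.fold (\<lambda>i. pd (Some i) ^^ vec_nth (snd k) i) f UNIV)"

definition op_apply :: "'d::finite diff_op \<Rightarrow> 'd expr \<Rightarrow> 'd expr" where
  "op_apply P F = (\<lambda>m. \<Sum>k\<in>Poly_Mapping.keys P. Poly_Mapping.lookup P k *\<^sub>R deriv_mono k (F m))"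

definition series_apply :: "'d::finite series \<Rightarrow> 'd expr fps \<Rightarrow> 'd expr fps" where
  "series_apply \<Phi> F = Abs_fps (\<lambda>n. \<Sum>r\<le>n. op_apply (fps_nth \<Phi> r) (fps_nth F (n - r)))"

definition mat_apply :: "'d::finite series mat \<Rightarrow> (nat \<Rightarrow> 'd expr fps) \<Rightarrow> nat \<Rightarrow> 'd expr fps" where
  "mat_apply P v i = (\<Sum>j<dim_col P. series_apply (P $$ (i, j)) (v j))"

definition moment :: "nat \<Rightarrow> 'd::finite expr fps" where
  "moment i = fps_const (\<lambda>m. m i)"

definition compose_moments :: "nat \<Rightarrow> (real vec \<Rightarrow> real) \<Rightarrow> 'd::finite expr" where
  "compose_moments N g = (\<lambda>m. Abs_sfield (\<lambda>p. g (vec N (\<lambda>i. Rep_sfield (m i) p))))"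

definition meq :: "'d::finite lbm \<Rightarrow> nat \<Rightarrow> 'd expr fps" where
  "meq L j = fps_const (compose_moments (ncons L) (\<lambda>u. equil L u $ j))"

text \<open>Differential expressions in the conserved moments, with derivatives along the coordinates
  in \<open>J\<close> only.\<close>

inductive_set diff_exprs :: "nat \<Rightarrow> 'd::finite option set \<Rightarrow> 'd expr set" for N J where
  "smooth_of_moments TYPE('d) N g \<Longrightarrow> compose_moments N g \<in> diff_exprs N J"
| "F \<in> diff_exprs N J \<Longrightarrow> G \<in> diff_exprs N J \<Longrightarrow> F + G \<in> diff_exprs N J"
| "F \<in> diff_exprs N J \<Longrightarrow> G \<in> diff_exprs N J \<Longrightarrow> F * G \<in> diff_exprs N J"
| "F \<in> diff_exprs N J \<Longrightarrow> i \<in> J \<Longrightarrow> (\<lambda>m. pd i (F m)) \<in> diff_exprs N J"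

section \<open>Maxwell iteration and expansions\<close>

definition maxwell_op :: "'d::finite lbm \<Rightarrow> real fps \<Rightarrow> nat \<Rightarrow> 'd series mat" where
  "maxwell_op L \<tau> k = mat (nmom L) (nmom L) (\<lambda>ij. \<Sum>r\<le>k. ((- maxwell_mat L \<tau>) ^\<^sub>m r) $$ ij)"

definition maxwell :: "'d::finite lbm \<Rightarrow> real fps \<Rightarrow> nat \<Rightarrow> nat \<Rightarrow> 'd expr fps" where
  "maxwell L \<tau> k = mat_apply (maxwell_op L \<tau> k) (meq L)"

text \<open>Left-hand side minus right-hand side of the \<open>i\<close>-th corresponding Finite Difference scheme,
  every discrete operator being replaced by its asymptotic equivalent.\<close>

definition fd_expansion :: "'d::finite lbm \<Rightarrow> real fps \<Rightarrow> nat \<Rightarrow> 'd expr fps" where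
  "fd_expansion L \<tau> i =
     series_apply (asym \<tau> (det (fd_mat L i))) (moment i)
     - mat_apply (map_mat (asym \<tau>) (adj_mat (fd_mat L i) * disc_A_diamond L i)) moment i
     - mat_apply (map_mat (asym \<tau>) (adj_mat (fd_mat L i) * disc_B L)) (meq L) i"

section \<open>Modified equations\<close>

text \<open>
  A formal equation \<open>E = O((\<Delta>x)\<^bsup>p+1\<^esup>)\<close> is represented by its left-hand side \<open>E\<close>, truncated after
  the power \<open>p\<close>. An expansion method is given by the predicate \<open>src\<close>: \<open>src p i E\<close> says that \<open>E\<close> is
  its \<open>i\<close>-th equation, truncated at order \<open>p\<close>.

  \<open>obtained N src p i E\<close> says that \<open>E\<close> can be obtained from the \<open>i\<close>-th equation at order \<open>p\<close> by
  dividing by constants and by using equations obtained at previous orders \<open>p' < p\<close>,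
  differentiated, multiplied by a factor \<open>a\<close>, and shifted by the power \<open>(\<Delta>x)\<^bsup>p-p'\<^esup>\<close>, which makes
  their remainder \<open>O((\<Delta>x)\<^bsup>p+1\<^esup>)\<close>. The factor \<open>a\<close> is there since time derivatives of non-linear
  functions of the moments are eliminated: substituting \<open>\<partial>\<^sub>t m\<^sub>1 = R\<close> in \<open>\<partial>\<^sub>t (m\<^sub>1\<^sup>2)\<close>
  means adding \<open>-2 m\<^sub>1\<close> times \<open>\<partial>\<^sub>t m\<^sub>1 - R\<close>.
\<close>

inductive obtained ::
    "nat \<Rightarrow> (nat \<Rightarrow> nat \<Rightarrow> 'd::finite expr fps \<Rightarrow> bool) \<Rightarrow> nat \<Rightarrow> nat \<Rightarrow> 'd expr fps \<Rightarrow> bool"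
  for N src where
  truncate: "i < N \<Longrightarrow> src p i E \<Longrightarrow> obtained N src p i E"
| divide: "obtained N src p i E \<Longrightarrow> c \<noteq> 0 \<Longrightarrow>
    obtained N src p i (fps_const (\<lambda>_. of_real (1 / c)) * E)"
| reinject: "obtained N src p i E \<Longrightarrow> p' < p \<Longrightarrow> obtained N src p' j E' \<Longrightarrow>
    a \<in> diff_exprs N UNIV \<Longrightarrow>
    obtained N src p i
      (E + fps_X ^ (p - p') * (fps_const a * Abs_fps (\<lambda>n m. deriv_mono k (fps_nth E' n m))))"

text \<open>The modified equations at order \<open>p\<close>: those equations obtained as above which read
  \<open>\<Delta>t \<partial>\<^sub>t m\<^sub>i + G = O((\<Delta>x)\<^bsup>p+1\<^esup>)\<close>, \<open>\<Delta>t\<close> being the series \<open>\<tau>\<close>, where no time derivative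
  is left in \<open>G\<close>.\<close>

definition dt_moment :: "real fps \<Rightarrow> nat \<Rightarrow> 'd::finite expr fps" where
  "dt_moment \<tau> i = Abs_fps (\<lambda>n m. fps_nth \<tau> n *\<^sub>R pd None (m i))"

definition modified_equations ::
    "nat \<Rightarrow> real fps \<Rightarrow> (nat \<Rightarrow> nat \<Rightarrow> 'd::finite expr fps \<Rightarrow> bool) \<Rightarrow> nat \<Rightarrow> nat \<Rightarrow> 'd expr fps set" where
  "modified_equations N \<tau> src p i = {E. obtained N src p i E \<and>
     (\<exists>G. (\<forall>n. fps_nth G n \<in> diff_exprs N (range Some)) \<and>
          E = fps_cutoff (Suc p) (dt_moment \<tau> i) + G)}"

definition fd_source :: "'d::finite lbm \<Rightarrow> real fps \<Rightarrow> nat \<Rightarrow> nat \<Rightarrow> 'd expr fps \<Rightarrow> bool" where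
  "fd_source L \<tau> p i E \<longleftrightarrow> E = fps_cutoff (Suc p) (fd_expansion L \<tau> i)"

text \<open>Since \<open>m = m\<^sup>[\<^sup>k\<^sup>] + O((\<Delta>x)\<^bsup>k+1\<^esup>)\<close>, any \<open>k \<ge> p\<close> may be used at order \<open>p\<close>.\<close>

definition maxwell_source :: "'d::finite lbm \<Rightarrow> real fps \<Rightarrow> nat \<Rightarrow> nat \<Rightarrow> 'd expr fps \<Rightarrow> bool" where
  "maxwell_source L \<tau> p i E \<longleftrightarrow>
     (\<exists>k\<ge>p. E = fps_cutoff (Suc p) (moment i - maxwell L \<tau> k i))"

definition fd_modified_equations :: "'d::finite lbm \<Rightarrow> real fps \<Rightarrow> nat \<Rightarrow> nat \<Rightarrow> 'd expr fps set" where
  "fd_modified_equations L \<tau> = modified_equations (ncons L) \<tau> (fd_source L \<tau>)"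

definition maxwell_modified_equations :: "'d::finite lbm \<Rightarrow> real fps \<Rightarrow> nat \<Rightarrow> nat \<Rightarrow> 'd expr fps set" where
  "maxwell_modified_equations L \<tau> = modified_equations (ncons L) \<tau> (maxwell_source L \<tau>)"

text \<open>\<open>\<Sum>r. X\<^sup>r\<close>, entrywise for the topology of formal power series.\<close>

definition mat_geometric :: "'d::finite series mat \<Rightarrow> 'd series mat" where
  "mat_geometric X = mat (dim_row X) (dim_row X) (\<lambda>ij. suminf (\<lambda>r. (X ^\<^sub>m r) $$ ij))"

end

(* The formal solution m_inf = (zeta I - A)^-1 B m_eq of the scheme is the limit of the Maxwell
   iteration, as zeta I - A = T S (I + X) where X = S^-1 (zeta Tbar - I) is O(dx), so that the
   Neumann series of I + X converges. Writing W = m - m_inf for the defect, the i-th Finite Difference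
   scheme expands to det(zeta I - A_i) W_i - (adj(zeta I - A_i) A_i^diamond W)_i. Row i of the second
   operator vanishes outside the conserved moments and is O(dx), whereas det(zeta I - A_i) is a nonzero
   constant up to O(dx). Hence, order by order, the truncated Finite Difference equations and the
   truncated equations W_i = O(dx^(p+1)) are obtained from one another by dividing by constants and
   re-injecting equations of lower order. *)

theory Submission
  imports Defs
begin

text \<open>Why row i of adj(zeta I - A_i) A_i^diamond has the stated form: the columns of zeta I -
  A_i at the other conserved indices are zeta times unit vectors and zeta is a unit, so row i of the
  adjugate vanishes there. Only entries of A with a kept row and a removed column survive; they are
  off-diagonal, and at order zero A is the diagonal matrix I - S, since every shift starts with the
  identity. With several conserved moments the two systems differ by a matrix of series, not by one
  factor, so recovering an equation at order p uses all equations of lower orders at once. The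
  entries of that matrix have constant coefficients, so re-injections with constant factors suffice
  to pass between the systems. The algebra rests on expressions forming a module over the series
  ring, which needs commuting derivatives, and on asymptotic replacement being a ring
  homomorphism.\<close>

section \<open>Extension of functions on monomials\<close>

text \<open>Common shape of \<open>op_apply\<close> and \<open>asym\<close>. Keys may cancel in a
  sum, so additivity is proved over a common finite superset of the supports.\<close>

definition lift_pm :: "('k \<Rightarrow> real \<Rightarrow> 'b::comm_monoid_add) \<Rightarrow> ('k \<Rightarrow>\<^sub>0 real) \<Rightarrow> 'b" where
  "lift_pm g P = (\<Sum>k\<in>Poly_Mapping.keys P. g k (Poly_Mapping.lookup P k))"

lemma lift_pm_superset:
  assumes "finite A" "Poly_Mapping.keys P \<subseteq> A" "\<And>k. g k 0 = 0"
  shows "lift_pm g P = (\<Sum>k\<in>A. g k (Poly_Mapping.lookup P k))"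
  unfolding lift_pm_def using assms by (intro sum.mono_neutral_left) (auto simp: in_keys_iff)

lemma lift_pm_add:
  assumes "\<And>k. g k 0 = 0" "\<And>k a b. g k (a + b) = g k a + g k b"
  shows "lift_pm g (P + Q) = lift_pm g P + lift_pm g Q"
proof -
  let ?A = "Poly_Mapping.keys P \<union> Poly_Mapping.keys Q"
  have "finite ?A" "Poly_Mapping.keys (P + Q) \<subseteq> ?A"
    by (auto simp: Poly_Mapping.keys_add)
  then show ?thesis
    using assms by (simp add: lift_pm_superset[of ?A] lookup_add sum.distrib)
qed

lemma lift_pm_0 [simp]: "lift_pm g 0 = 0"
  by (simp add: lift_pm_def)

lemma lift_pm_single:
  assumes "\<And>k. g k 0 = 0"
  shows "lift_pm g (Poly_Mapping.single k c) = g k c"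
  using assms by (simp add: lift_pm_superset[of "{k}"])

text \<open>Reduces identities that are additive in an operator to single monomials.\<close>

lemma poly_mapping_single_induct [case_names zero single add]:
  fixes P :: "'k \<Rightarrow>\<^sub>0 real"
  assumes "A 0" "\<And>k c. A (Poly_Mapping.single k c)" "\<And>P Q. A P \<Longrightarrow> A Q \<Longrightarrow> A (P + Q)"
  shows "A P"
proof (induction P rule: Poly_Mapping.update_induct)
  case const
  then show ?case by (rule assms(1))
next
  case (update f a b)
  have "Poly_Mapping.update a b f = f + Poly_Mapping.single a b"
    using update by (intro poly_mapping_eqI) (auto simp: lookup_update lookup_add lookup_single in_keys_iff)
  with update assms show ?case by metis
qed

section \<open>The action of differential operators on expressions\<close>

lemma pd_add: "pd i (f + g) = pd i f + pd i g"
  by transfer (simp add: partial_add smooth_differentiable)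

lemma pd_scaleR: "pd i (c *\<^sub>R f) = c *\<^sub>R pd i (f :: 'd::finite sfield)"
proof transfer
  fix i c and f :: "real \<times> (real ^ 'd) \<Rightarrow> real"
  assume "smooth f"
  then show "partial i (\<lambda>p. c * f p) = (\<lambda>p. c * partial i f p)"
    using partial_mult[of "\<lambda>_. c" f i] by (simp add: partial_const smooth_differentiable)
qed

lemma funpow_additive:
  fixes D :: "'a::plus \<Rightarrow> 'a"
  assumes "\<And>f g. D (f + g) = D f + D g"
  shows "(D ^^ n) (f + g) = (D ^^ n) f + (D ^^ n) g"
  by (induction n) (simp_all add: assms)

lemma funpow_scaleR:
  fixes D :: "'a::real_vector \<Rightarrow> 'a"
  assumes "\<And>c f. D (c *\<^sub>R f) = c *\<^sub>R D f"
  shows "(D ^^ n) (c *\<^sub>R f) = c *\<^sub>R (D ^^ n) f"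
  by (induction n) (simp_all add: assms)

lemma funpow_commute2:
  assumes "\<And>f. D (E f) = E (D f)"
  shows "(D ^^ n) ((E ^^ k) f) = (E ^^ k) ((D ^^ n) f)"
proof -
  have *: "D ((E ^^ k) f) = (E ^^ k) (D f)" for f
    by (induction k) (simp_all add: assms)
  show ?thesis by (induction n) (simp_all add: *)
qed

text \<open>Generalises the fold in \<open>deriv_mono\<close> from \<open>UNIV\<close> to any set of
  coordinates, so that set induction applies.\<close>

definition space_deriv :: "nat ^ 'd \<Rightarrow> 'd::finite set \<Rightarrow> 'd sfield \<Rightarrow> 'd sfield" where
  "space_deriv \<nu> A f = Finite_Set.fold (\<lambda>i. pd (Some i) ^^ vec_nth \<nu> i) f A"

lemma space_deriv_empty [simp]: "space_deriv \<nu> {} f = f"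
  by (simp add: space_deriv_def)

lemma comp_fun_commute_space_deriv:
  "comp_fun_commute_on UNIV (\<lambda>i. pd (Some i) ^^ vec_nth \<nu> i)"
  by standard (auto simp: fun_eq_iff intro!: funpow_commute2 pd_commute)

lemma space_deriv_insert:
  assumes "i \<notin> A"
  shows "space_deriv \<nu> (insert i A) f = (pd (Some i) ^^ vec_nth \<nu> i) (space_deriv \<nu> A f)"
  using comp_fun_commute_on.fold_insert[OF comp_fun_commute_space_deriv, of i A \<nu> f] assms
  by (simp add: space_deriv_def)

lemma space_deriv_add: "space_deriv \<nu> A (f + g) = space_deriv \<nu> A f + space_deriv \<nu> A g"
  using finite[of A]
  by (induction A rule: finite_induct) (simp_all add: space_deriv_insert funpow_additive pd_add)

lemma space_deriv_scaleR: "space_deriv \<nu> A (c *\<^sub>R f) = c *\<^sub>R space_deriv \<nu> A f"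
  using finite[of A]
  by (induction A rule: finite_induct) (simp_all add: space_deriv_insert funpow_scaleR pd_scaleR)

lemma pd_funpow_commute: "(pd i ^^ n) ((pd j ^^ k) f) = (pd j ^^ k) ((pd i ^^ n) f)"
  by (rule funpow_commute2) (rule pd_commute)

lemma space_deriv_pd: "space_deriv \<nu> A ((pd i ^^ n) f) = (pd i ^^ n) (space_deriv \<nu> A f)"
  using finite[of A]
proof (induction A rule: finite_induct)
  case (insert j A)
  then show ?case by (simp add: space_deriv_insert pd_funpow_commute[of _ "Some j"])
qed simp

lemma space_deriv_plus:
  "space_deriv (\<nu> + \<mu>) A f = space_deriv \<nu> A (space_deriv \<mu> A f)"
  using finite[of A]
  by (induction A rule: finite_induct) (simp_all add: space_deriv_insert funpow_add space_deriv_pd pd_funpow_commute)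

lemma deriv_mono_eq: "deriv_mono k f = (pd None ^^ fst k) (space_deriv (snd k) UNIV f)"
  by (simp add: deriv_mono_def space_deriv_def)

lemma deriv_mono_add: "deriv_mono k (f + g) = deriv_mono k f + deriv_mono k g"
  by (simp add: deriv_mono_eq space_deriv_add funpow_additive pd_add)

lemma deriv_mono_scaleR: "deriv_mono k (c *\<^sub>R f) = c *\<^sub>R deriv_mono k f"
  by (simp add: deriv_mono_eq space_deriv_scaleR funpow_scaleR pd_scaleR)

lemma deriv_mono_plus: "deriv_mono (k + l) f = deriv_mono k (deriv_mono l f)"
  by (simp add: deriv_mono_eq space_deriv_plus funpow_add space_deriv_pd)

lemma deriv_mono_0: "deriv_mono 0 f = f"
proof -
  have "space_deriv 0 A f = f" for A
    using finite[of A]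
    by (induction A rule: finite_induct) (simp_all add: space_deriv_insert)
  then show ?thesis by (simp add: deriv_mono_eq)
qed

lemma deriv_mono_zero: "deriv_mono k 0 = 0"
  using deriv_mono_scaleR[of k 0 0] by simp

lemma op_apply_lift:
  "op_apply P F m = lift_pm (\<lambda>k c. c *\<^sub>R deriv_mono k (F m)) P"
  by (simp add: op_apply_def lift_pm_def)

lemma op_apply_add_left: "op_apply (P + Q) F = op_apply P F + op_apply Q F"
  by (simp add: fun_eq_iff op_apply_lift lift_pm_add scaleR_left_distrib)

lemma op_apply_add_right: "op_apply P (F + G) = op_apply P F + op_apply P G"
  by (simp add: fun_eq_iff op_apply_def deriv_mono_add scaleR_right_distrib sum.distrib)

lemma op_apply_0_left [simp]: "op_apply 0 F = 0"
  by (simp add: fun_eq_iff op_apply_def)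

lemma op_apply_0_right [simp]: "op_apply P 0 = 0"
  by (simp add: fun_eq_iff op_apply_def deriv_mono_zero)

lemma op_apply_single:
  "op_apply (Poly_Mapping.single k c) F = (\<lambda>m. c *\<^sub>R deriv_mono k (F m))"
  by (simp add: fun_eq_iff op_apply_lift lift_pm_single)

lemma op_apply_const: "op_apply (const_op c) F = (\<lambda>m. c *\<^sub>R F m)"
  by (simp add: const_op_def op_apply_single deriv_mono_0)

lemma op_apply_1 [simp]: "op_apply 1 F = F"
  using op_apply_const[of 1 F] by (simp add: const_op_def)

text \<open>Both sides are additive in \<open>P\<close> and in \<open>Q\<close>; on monomials
  exponents add, which is \<open>deriv_mono_plus\<close>.\<close>

lemma op_apply_mult: "op_apply (P * Q) F = op_apply P (op_apply Q F)"
proof (induction P rule: poly_mapping_single_induct)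
  case (single k c)
  show ?case
  proof (induction Q rule: poly_mapping_single_induct)
    case zero
    show ?case by (simp only: mult_zero_right op_apply_0_left op_apply_0_right)
  next
    case (single l d)
    show ?case
      by (simp add: mult_single op_apply_single deriv_mono_plus deriv_mono_scaleR)
  next
    case (add P Q)
    then show ?case by (simp only: distrib_left op_apply_add_left op_apply_add_right)
  qed
qed (simp_all add: distrib_right op_apply_add_left)

lemma op_apply_sum_left: "op_apply (\<Sum>x\<in>A. P x) F = (\<Sum>x\<in>A. op_apply (P x) F)"
  by (induction A rule: infinite_finite_induct) (simp_all add: op_apply_add_left)

lemma op_apply_sum_right: "op_apply P (\<Sum>x\<in>A. F x) = (\<Sum>x\<in>A. op_apply P (F x))"
  using sum_comp_morphism[of "op_apply P" F A, symmetric]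
  by (simp only: op_apply_0_right op_apply_add_right o_def)

section \<open>Formal series acting on series of expressions\<close>

lemma series_apply_nth:
  "fps_nth (series_apply \<Phi> F) n = (\<Sum>r\<le>n. op_apply (fps_nth \<Phi> r) (fps_nth F (n - r)))"
  by (simp add: series_apply_def)

lemma series_apply_add_left: "series_apply (\<Phi> + \<Psi>) F = series_apply \<Phi> F + series_apply \<Psi> F"
  by (simp add: fps_eq_iff series_apply_nth op_apply_add_left sum.distrib)

lemma series_apply_add_right: "series_apply \<Phi> (F + G) = series_apply \<Phi> F + series_apply \<Phi> G"
  by (simp add: fps_eq_iff series_apply_nth op_apply_add_right sum.distrib)

lemma series_apply_0_left [simp]: "series_apply 0 F = 0"
  by (simp add: fps_eq_iff series_apply_nth)

lemma series_apply_0_right [simp]: "series_apply \<Phi> 0 = 0"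
  by (simp add: fps_eq_iff series_apply_nth)

lemma series_apply_minus_left: "series_apply (- \<Phi>) F = - series_apply \<Phi> F"
  using series_apply_add_left[of "- \<Phi>" \<Phi> F] by (simp add: eq_neg_iff_add_eq_0)

lemma series_apply_minus_right: "series_apply \<Phi> (- F) = - series_apply \<Phi> F"
  using series_apply_add_right[of \<Phi> "- F" F] by (simp add: eq_neg_iff_add_eq_0)

lemma series_apply_diff_left: "series_apply (\<Phi> - \<Psi>) F = series_apply \<Phi> F - series_apply \<Psi> F"
  using series_apply_add_left[of \<Phi> "- \<Psi>" F] by (simp add: series_apply_minus_left)

lemma series_apply_diff_right: "series_apply \<Phi> (F - G) = series_apply \<Phi> F - series_apply \<Phi> G"
  using series_apply_add_right[of \<Phi> F "- G"] by (simp add: series_apply_minus_right)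

lemma series_apply_sum_left: "series_apply (\<Sum>x\<in>A. \<Phi> x) F = (\<Sum>x\<in>A. series_apply (\<Phi> x) F)"
  by (induction A rule: infinite_finite_induct) (simp_all add: series_apply_add_left)

lemma series_apply_sum_right: "series_apply \<Phi> (\<Sum>x\<in>A. F x) = (\<Sum>x\<in>A. series_apply \<Phi> (F x))"
  by (induction A rule: infinite_finite_induct) (simp_all add: series_apply_add_right)

lemma series_apply_1 [simp]: "series_apply 1 F = F"
proof -
  have "(\<Sum>r\<le>n. op_apply (fps_nth 1 r) (fps_nth F (n - r))) = fps_nth F n" for n
    by (subst sum.mono_neutral_right[of _ "{0}"]) auto
  then show ?thesis by (simp add: fps_eq_iff series_apply_nth)
qed

text \<open>Associativity of the Cauchy product, by reindexing the triangle of orders. It is what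
  makes matrices of series act compatibly with their product.\<close>

lemma series_apply_mult: "series_apply (\<Phi> * \<Psi>) F = series_apply \<Phi> (series_apply \<Psi> F)"
proof (rule fps_ext)
  fix n
  define h where "h i j = op_apply (fps_nth \<Phi> i) (op_apply (fps_nth \<Psi> j) (fps_nth F (n - (i + j))))" for i j
  have "fps_nth (series_apply (\<Phi> * \<Psi>) F) n = (\<Sum>r\<le>n. \<Sum>i\<le>r. h i (r - i))"
    by (simp add: series_apply_nth fps_mult_nth op_apply_sum_left op_apply_mult h_def atLeast0AtMost)
  also have "\<dots> = (\<Sum>(i, j)\<in>{(i, j). i + j \<le> n}. h i j)"
    by (rule sum.triangle_reindex_eq[symmetric])
  also have "{(i, j). i + j \<le> n} = Sigma {..n} (\<lambda>i. {..n - i})"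
    by auto
  also have "(\<Sum>(i, j)\<in>Sigma {..n} (\<lambda>i. {..n - i}). h i j) = (\<Sum>i\<le>n. \<Sum>j\<le>n - i. h i j)"
    by (rule sum.Sigma[symmetric]) auto
  also have "\<dots> = fps_nth (series_apply \<Phi> (series_apply \<Psi> F)) n"
    by (simp add: series_apply_nth op_apply_sum_right h_def)
  finally show "fps_nth (series_apply (\<Phi> * \<Psi>) F) n = fps_nth (series_apply \<Phi> (series_apply \<Psi> F)) n" .
qed

section \<open>Shifts and their asymptotic equivalents\<close>

text \<open>Each component is at most \<open>n\<close>. Sums over infinite sets default to 0, so the
  coefficients of \<open>shift_series\<close> need this finiteness to be meaningful.\<close>

lemma finite_multi_index [simp]: "finite {\<nu> :: nat ^ 'd::finite. (\<Sum>i\<in>UNIV. vec_nth \<nu> i) = n}"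
proof (rule finite_subset)
  show "{\<nu> :: nat ^ 'd. (\<Sum>i\<in>UNIV. vec_nth \<nu> i) = n} \<subseteq> vec_lambda ` (PiE UNIV (\<lambda>_. {..n}))"
  proof
    fix \<nu> :: "nat ^ 'd"
    assume "\<nu> \<in> {\<nu>. (\<Sum>i\<in>UNIV. vec_nth \<nu> i) = n}"
    then have "vec_nth \<nu> i \<le> n" for i
      using member_le_sum[of i UNIV "vec_nth \<nu>"] by auto
    then have "vec_nth \<nu> \<in> PiE UNIV (\<lambda>_. {..n})" by auto
    then show "\<nu> \<in> vec_lambda ` (PiE UNIV (\<lambda>_. {..n}))"
      by (metis image_eqI vec_nth_inverse)
  qed
  show "finite (vec_lambda ` (PiE (UNIV :: 'd set) (\<lambda>_. {..n})))"
    by (intro finite_imageI finite_PiE) auto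
qed

definition exp_coeff :: "('d::finite \<Rightarrow> real) \<Rightarrow> nat ^ 'd \<Rightarrow> real" where
  "exp_coeff a \<nu> = (\<Prod>i\<in>UNIV. a i ^ vec_nth \<nu> i / fact (vec_nth \<nu> i))"

text \<open>The series of \<open>exp (\<Delta>x (\<Sum>i. a\<^sub>i \<partial>\<^sub>i))\<close>; the shift series are of this form, which makes them
  multiplicative in the shift.\<close>

definition exp_series :: "('d::finite \<Rightarrow> real) \<Rightarrow> 'd series" where
  "exp_series a = Abs_fps (\<lambda>n. \<Sum>\<nu> | (\<Sum>i\<in>UNIV. vec_nth \<nu> i) = n.
     Poly_Mapping.single (0, \<nu>) (exp_coeff a \<nu>))"

text \<open>As \<open>n\<close> is the total degree of the multi-index, \<open>\<sigma> ^ n\<close>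
  splits into one factor per coordinate.\<close>

lemma shift_series_eq: "shift_series \<sigma> z = exp_series (\<lambda>i. \<sigma> * real_of_int (vec_nth z i))"
proof -
  have "\<sigma> ^ (\<Sum>i\<in>UNIV. vec_nth \<nu> i) *
      (\<Prod>i\<in>UNIV. real_of_int (vec_nth z i) ^ vec_nth \<nu> i / fact (vec_nth \<nu> i))
    = exp_coeff (\<lambda>i. \<sigma> * real_of_int (vec_nth z i)) \<nu>" for \<nu>
    by (simp add: exp_coeff_def power_sum power_mult_distrib prod.distrib[symmetric])
  then show ?thesis
    unfolding shift_series_def exp_series_def
    by (intro arg_cong[of _ _ Abs_fps] ext sum.cong) auto
qed

text \<open>Multivariate binomial theorem divided by factorials: the one-dimensional theorem in each
  coordinate, then the product is distributed over the sums. Only multi-indices below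
  \<open>\<rho>\<close> occur, so the truncated subtraction is exact.\<close>

lemma exp_coeff_add:
  "(\<Sum>\<nu> | \<forall>i. vec_nth \<nu> i \<le> vec_nth \<rho> i. exp_coeff a \<nu> * exp_coeff b (\<rho> - \<nu>))
     = exp_coeff (\<lambda>i. a i + b i) \<rho>"
proof -
  define t where "t i k = (a i ^ k / fact k) * (b i ^ (vec_nth \<rho> i - k) / fact (vec_nth \<rho> i - k))" for i k
  have t: "(\<Sum>k\<le>vec_nth \<rho> i. t i k) = (a i + b i) ^ vec_nth \<rho> i / fact (vec_nth \<rho> i)" for i
  proof -
    have "(a i + b i) ^ vec_nth \<rho> i / fact (vec_nth \<rho> i)
        = (\<Sum>k\<le>vec_nth \<rho> i. real (vec_nth \<rho> i choose k) * a i ^ k * b i ^ (vec_nth \<rho> i - k) / fact (vec_nth \<rho> i))"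
      by (simp add: binomial_ring sum_divide_distrib)
    also have "\<dots> = (\<Sum>k\<le>vec_nth \<rho> i. t i k)"
      by (intro sum.cong refl) (simp add: t_def binomial_fact field_simps)
    finally show ?thesis ..
  qed
  have "exp_coeff (\<lambda>i. a i + b i) \<rho> = (\<Prod>i\<in>UNIV. \<Sum>k\<le>vec_nth \<rho> i. t i k)"
    by (simp add: exp_coeff_def t)
  also have "\<dots> = (\<Sum>g\<in>PiE UNIV (\<lambda>i. {..vec_nth \<rho> i}). \<Prod>i\<in>UNIV. t i (g i))"
    by (rule prod_sum_PiE) auto
  also have "\<dots> = (\<Sum>\<nu> | \<forall>i. vec_nth \<nu> i \<le> vec_nth \<rho> i. \<Prod>i\<in>UNIV. t i (vec_nth \<nu> i))"
    by (rule sum.reindex_bij_witness[of _ vec_nth vec_lambda]) (auto simp: vec_lambda_inverse)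
  also have "\<dots> = (\<Sum>\<nu> | \<forall>i. vec_nth \<nu> i \<le> vec_nth \<rho> i. exp_coeff a \<nu> * exp_coeff b (\<rho> - \<nu>))"
    by (intro sum.cong refl) (simp only: t_def exp_coeff_def prod.distrib[symmetric] vector_minus_component)
  finally show ?thesis ..
qed

lemma single_sum: "(\<Sum>x\<in>A. Poly_Mapping.single k (f x)) = Poly_Mapping.single k (\<Sum>x\<in>A. f x)"
  by (induction A rule: infinite_finite_induct) (simp_all add: single_add)

lemma exp_series_mult: "exp_series a * exp_series b = exp_series (\<lambda>i. a i + b i :: real)"
proof (rule fps_ext)
  fix n
  let ?D = "\<lambda>n. {\<nu> :: nat ^ 'a. (\<Sum>i\<in>UNIV. vec_nth \<nu> i) = n}"
  let ?L = "\<lambda>\<rho> :: nat ^ 'a. {\<nu>. \<forall>i. vec_nth \<nu> i \<le> vec_nth \<rho> i}"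
  let ?s = "\<lambda>\<nu> c. Poly_Mapping.single (0 :: nat, \<nu> :: nat ^ 'a) (c :: real)"
  have fin: "finite (?L \<rho>)" for \<rho>
  proof (rule finite_subset)
    show "?L \<rho> \<subseteq> vec_lambda ` (PiE UNIV (\<lambda>i. {..vec_nth \<rho> i}))"
    proof
      fix \<nu> assume "\<nu> \<in> ?L \<rho>"
      then have "vec_nth \<nu> \<in> PiE UNIV (\<lambda>i. {..vec_nth \<rho> i})" by auto
      then show "\<nu> \<in> vec_lambda ` (PiE UNIV (\<lambda>i. {..vec_nth \<rho> i}))"
        by (metis image_eqI vec_nth_inverse)
    qed
  qed (intro finite_imageI finite_PiE, auto)
  have "fps_nth (exp_series a * exp_series b) n
      = (\<Sum>i\<le>n. \<Sum>\<nu>\<in>?D i. \<Sum>\<mu>\<in>?D (n - i). ?s (\<nu> + \<mu>) (exp_coeff a \<nu> * exp_coeff b \<mu>))"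
    by (simp add: fps_mult_nth exp_series_def sum_product mult_single atLeast0AtMost)
  also have "\<dots> = (\<Sum>(i, \<nu>, \<mu>)\<in>Sigma {..n} (\<lambda>i. ?D i \<times> ?D (n - i)).
      ?s (\<nu> + \<mu>) (exp_coeff a \<nu> * exp_coeff b \<mu>))"
    by (simp add: sum.Sigma sum.cartesian_product)
  \<comment> \<open>A pair \<open>(\<nu>, \<mu>)\<close> is recorded by its sum
    \<open>\<rho>\<close> and by \<open>\<nu>\<close>; the index \<open>i\<close> is recovered as
    the degree of \<open>\<nu>\<close>.\<close>
  also have "\<dots> = (\<Sum>(\<rho>, \<nu>)\<in>Sigma (?D n) ?L. ?s \<rho> (exp_coeff a \<nu> * exp_coeff b (\<rho> - \<nu>)))"
    by (rule sum.reindex_bij_witness[of _ "\<lambda>(\<rho>, \<nu>). (\<Sum>i\<in>UNIV. vec_nth \<nu> i, \<nu>, \<rho> - \<nu>)"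
          "\<lambda>(i, \<nu>, \<mu>). (\<nu> + \<mu>, \<nu>)"])
      (auto simp: sum.distrib sum_subtractf_nat Finite_Cartesian_Product.vec_eq_iff intro: sum_mono)
  also have "\<dots> = (\<Sum>\<rho>\<in>?D n. \<Sum>\<nu>\<in>?L \<rho>. ?s \<rho> (exp_coeff a \<nu> * exp_coeff b (\<rho> - \<nu>)))"
    using fin by (simp add: sum.Sigma)
  also have "\<dots> = fps_nth (exp_series (\<lambda>i. a i + b i)) n"
    by (simp add: single_sum exp_coeff_add exp_series_def)
  finally show "fps_nth (exp_series a * exp_series b) n = fps_nth (exp_series (\<lambda>i. a i + b i)) n" .
qed

lemma sum_vec_eq_0_iff: "(\<Sum>i\<in>UNIV. vec_nth \<nu> i) = 0 \<longleftrightarrow> \<nu> = (0 :: nat ^ 'd::finite)"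
  by (auto simp: Finite_Cartesian_Product.vec_eq_iff)

lemma exp_series_nth_0: "fps_nth (exp_series a) 0 = 1"
  by (simp add: exp_series_def sum_vec_eq_0_iff exp_coeff_def flip: zero_prod_def)

lemma exp_series_0: "exp_series (\<lambda>i. 0) = 1"
proof (rule fps_ext)
  fix n
  show "fps_nth (exp_series (\<lambda>i :: 'a. 0)) n = fps_nth 1 n"
  proof (cases "n = 0")
    case False
    have "exp_coeff (\<lambda>i. 0) \<nu> = 0" if sum: "(\<Sum>i\<in>UNIV. vec_nth \<nu> i) = n" for \<nu> :: "nat ^ 'a"
    proof -
      obtain i where "vec_nth \<nu> i \<noteq> 0" using False sum by (metis sum.neutral)
      then show ?thesis unfolding exp_coeff_def by (intro prod_zero) auto
    qed
    with False show ?thesis by (simp add: exp_series_def)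
  qed (simp add: exp_series_nth_0)
qed

lemma shift_series_add: "shift_series \<sigma> (z + w) = shift_series \<sigma> z * shift_series \<sigma> w"
  by (simp add: shift_series_eq exp_series_mult distrib_left)

lemma shift_series_0: "shift_series \<sigma> 0 = 1"
  by (simp add: shift_series_eq exp_series_0)

lemma shift_series_inverse: "shift_series 1 z * shift_series (-1) z = 1"
  by (simp add: shift_series_eq exp_series_mult exp_series_0)

lemma shift_series_nth_0: "fps_nth (shift_series \<sigma> z) 0 = 1"
  by (simp add: shift_series_eq exp_series_nth_0)

lemma zeta_nth_0: "fps_nth (zeta \<tau>) 0 = 1"
  by (simp add: zeta_def flip: zero_prod_def)

section \<open>Embedding of constants and asymptotic replacement as ring homomorphisms\<close>

lemma const_op_hom:
  "const_op 0 = 0" "const_op 1 = 1" "const_op (a + b) = const_op a + const_op b"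
  "const_op (a * b) = const_op a * const_op b"
  by (simp_all add: const_op_def single_add mult_single)

lemma const_series_hom:
  "const_series 0 = 0" "const_series 1 = 1"
  "const_series (a + b) = const_series a + const_series b"
  "const_series (a * b) = const_series a * const_series b"
  by (simp_all add: const_series_def const_op_hom)

lemma asym_eq_lift:
  "asym \<tau> = lift_pm (\<lambda>k c. const_series c * zeta \<tau> ^ fst k * shift_series (-1) (snd k))"
  by (rule ext) (simp add: asym_def lift_pm_def)

lemma asym_single:
  "asym \<tau> (Poly_Mapping.single k c) = const_series c * zeta \<tau> ^ fst k * shift_series (-1) (snd k)"
  by (simp add: asym_eq_lift lift_pm_single const_series_hom)

lemma asym_add: "asym \<tau> (P + Q) = asym \<tau> P + asym \<tau> Q"
  unfolding asym_eq_lift by (intro lift_pm_add) (simp_all add: const_series_hom algebra_simps)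

lemma asym_0: "asym \<tau> 0 = 0"
  by (simp add: asym_eq_lift)

lemma asym_mult: "asym \<tau> (P * Q) = asym \<tau> P * asym \<tau> Q"
proof (induction P rule: poly_mapping_single_induct)
  case (single k c)
  show ?case
  proof (induction Q rule: poly_mapping_single_induct)
    case (single l d)
    show ?case
      by (simp add: mult_single asym_single const_series_hom power_add shift_series_add mult_ac)
  qed (simp_all add: asym_0 asym_add distrib_left)
qed (simp_all add: asym_0 asym_add distrib_right)

lemma asym_const: "asym \<tau> (const_op c) = const_series c"
  by (simp add: const_op_def asym_single shift_series_0)

lemma asym_time_shift: "asym \<tau> time_shift = zeta \<tau>"
  by (simp add: time_shift_def asym_single shift_series_0 const_series_hom)

lemma asym_space_shift: "asym \<tau> (space_shift z) = shift_series (-1) z"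
  by (simp add: space_shift_def asym_single const_series_hom)

text \<open>Asymptotic replacement thereby commutes with determinants and adjugates, where products
  of shifts occur.\<close>

lemma comm_ring_hom_asym: "comm_ring_hom (asym \<tau>)"
  by standard (simp_all add: asym_0 asym_add asym_mult const_series_hom
      asym_const[of _ 1, unfolded const_op_hom])

lemma comm_ring_hom_const_op: "comm_ring_hom const_op"
  by standard (simp_all add: const_op_hom)

lemma comm_ring_hom_const_series: "comm_ring_hom const_series"
  by standard (simp_all add: const_series_hom)

text \<open>Lets order-zero terms of determinants and products be computed from the matrices of
  order-zero terms.\<close>

lemma comm_ring_hom_fps_nth_0: "comm_ring_hom (\<lambda>F :: 'a::comm_ring_1 fps. fps_nth F 0)"
  by standard simp_all

section \<open>Equations obtained from one another\<close>

text \<open>Acts on each order in dx separately, so truncation orders are kept.\<close>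

definition op_series :: "'d::finite diff_op \<Rightarrow> 'd expr fps \<Rightarrow> 'd expr fps" where
  "op_series P F = Abs_fps (\<lambda>n. op_apply P (fps_nth F n))"

lemma op_series_nth [simp]: "fps_nth (op_series P F) n = op_apply P (fps_nth F n)"
  by (simp add: op_series_def)

lemma op_series_add_left: "op_series (P + Q) F = op_series P F + op_series Q F"
  by (simp add: fps_eq_iff op_apply_add_left)

lemma op_series_minus_left: "op_series (- P) F = - op_series P F"
proof -
  have "op_series (- P) F + op_series P F = 0"
    unfolding op_series_add_left[symmetric] by (simp add: fps_eq_iff)
  then show ?thesis by (simp add: eq_neg_iff_add_eq_0)
qed

lemma op_series_mult: "op_series (P * Q) F = op_series P (op_series Q F)"
  by (simp add: fps_eq_iff op_apply_mult)

lemma op_series_1 [simp]: "op_series 1 F = F"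
  by (simp add: fps_eq_iff)

text \<open>A constant is a composition with a constant function, hence an admissible factor in
  \<open>reinject\<close>.\<close>

lemma const_in_diff_exprs: "(\<lambda>_. of_real c) \<in> (diff_exprs N J :: 'd::finite expr set)"
proof -
  have "Rep_sfield (of_real c :: 'd sfield) = (\<lambda>_. c)"
    by (simp add: of_real_def scaleR_sfield.rep_eq one_sfield.rep_eq)
  then have "Abs_sfield (\<lambda>_. c) = (of_real c :: 'd sfield)"
    using Rep_sfield_inverse[of "of_real c :: 'd sfield"] by simp
  then have "(\<lambda>_. of_real c) = (compose_moments N (\<lambda>_. c) :: 'd expr)"
    by (simp add: compose_moments_def)
  also have "\<dots> \<in> diff_exprs N J"
    by (rule diff_exprs.intros(1)) (simp add: smooth_of_moments_def smooth_const)
  finally show ?thesis .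
qed

lemma const_mult_nth:
  "fps_nth (fps_const (\<lambda>_. of_real c) * F) n = op_apply (const_op c) (fps_nth F n)"
  by (simp add: fun_eq_iff op_apply_const of_real_def)

lemma op_series_const: "op_series (const_op c) F = fps_const (\<lambda>_. of_real c) * F"
  by (simp only: fps_eq_iff const_mult_nth op_series_nth) simp

lemma obtained_scale:
  assumes "obtained N src p i E" "c \<noteq> 0"
  shows "obtained N src p i (op_series (const_op c) E)"
  using obtained.divide[OF assms(1), of "1 / c"] assms(2) by (simp add: op_series_const)

text \<open>Rule \<open>reinject\<close> adds one differentiated monomial at a time; induction on
  \<open>P\<close> with \<open>E\<close> arbitrary accumulates them.\<close>

lemma obtained_add_op_series:
  assumes "obtained N src p i E" "p' < p" "obtained N src p' j E'"
  shows "obtained N src p i (E + fps_X ^ (p - p') * op_series P E')"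
  using assms(1)
proof (induction P arbitrary: E rule: poly_mapping_single_induct)
  case zero
  moreover have "op_series 0 E' = 0"
    by (simp add: fps_eq_iff)
  ultimately show ?case by simp
next
  case (single k c)
  have "fps_const (\<lambda>_. of_real c) * Abs_fps (\<lambda>n m. deriv_mono k (fps_nth E' n m))
      = op_series (Poly_Mapping.single k c) E'"
    by (simp only: fps_eq_iff const_mult_nth op_series_nth) (simp add: op_apply_const op_apply_single)
  then show ?case
    using obtained.reinject[OF single assms(2,3) const_in_diff_exprs, of c k] by simp
next
  case (add P Q)
  have "E + fps_X ^ (p - p') * op_series (P + Q) E'
      = (E + fps_X ^ (p - p') * op_series P E') + fps_X ^ (p - p') * op_series Q E'"
    by (simp only: op_series_add_left distrib_left add.assoc)
  moreover have "obtained N src p i ((E + fps_X ^ (p - p') * op_series P E') + fps_X ^ (p - p') * op_series Q E')"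
    using add by blast
  ultimately show ?case by (simp only:)
qed

text \<open>The bound \<open>0 < r x\<close> makes the re-injected equation one of a previous order,
  and \<open>r x \<le> p\<close> makes \<open>p - (p - r x)\<close> equal to
  \<open>r x\<close>.\<close>

lemma obtained_add_sum:
  assumes "finite A" "obtained N src p i E"
    and "\<And>x. x \<in> A \<Longrightarrow> 0 < r x \<and> r x \<le> p \<and> obtained N src (p - r x) (j x) (E' x)"
  shows "obtained N src p i (E + (\<Sum>x\<in>A. fps_X ^ r x * op_series (P x) (E' x)))"
  using assms(1,3)
proof (induction A rule: finite_induct)
  case empty
  then show ?case using assms(2) by simp
next
  case (insert x A)
  then have r: "0 < r x" "r x \<le> p" and "obtained N src (p - r x) (j x) (E' x)"
    and "obtained N src p i (E + (\<Sum>x\<in>A. fps_X ^ r x * op_series (P x) (E' x)))"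
    by auto
  then have "obtained N src p i (E + (\<Sum>x\<in>A. fps_X ^ r x * op_series (P x) (E' x))
      + fps_X ^ (p - (p - r x)) * op_series (P x) (E' x))"
    by (intro obtained_add_op_series) auto
  moreover have "E + (\<Sum>x\<in>A. fps_X ^ r x * op_series (P x) (E' x))
      + fps_X ^ (p - (p - r x)) * op_series (P x) (E' x)
    = E + (\<Sum>x\<in>insert x A. fps_X ^ r x * op_series (P x) (E' x))"
    using insert(1,2) r by (simp add: add_ac)
  ultimately show ?case by simp
qed

text \<open>A derivation is replayed with its leaves replaced by derivations from the other source;
  division and re-injection, non-linear factors included, carry over unchanged.\<close>

lemma obtained_trans:
  assumes "obtained N src p i E"
    and "\<And>p i E. i < N \<Longrightarrow> src p i E \<Longrightarrow> obtained N src' p i E"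
  shows "obtained N src' p i E"
  using assms(1)
proof induction
  case (truncate i p E)
  then show ?case by (rule assms(2))
next
  case (divide p i E c)
  then show ?case by (intro obtained.divide)
next
  case (reinject p i E p' j E' a k)
  then show ?case by (intro obtained.reinject)
qed

text \<open>A coefficient of order \<open>r\<close> shifts by \<open>r\<close> and so meets the
  series truncated after \<open>p - r\<close>: the form in which lower-order equations are
  re-injected.\<close>

lemma fps_cutoff_series_apply:
  "fps_cutoff (Suc p) (series_apply \<Phi> F)
     = (\<Sum>r\<le>p. fps_X ^ r * op_series (fps_nth \<Phi> r) (fps_cutoff (Suc (p - r)) F))"
proof (rule fps_ext)
  fix n
  have "fps_nth (\<Sum>r\<le>p. fps_X ^ r * op_series (fps_nth \<Phi> r) (fps_cutoff (Suc (p - r)) F)) n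
      = (\<Sum>r\<le>p. if r \<le> n \<and> n \<le> p then op_apply (fps_nth \<Phi> r) (fps_nth F (n - r)) else 0)"
    unfolding fps_sum_nth by (intro sum.cong refl) (auto simp: fps_X_power_mult_nth)
  also have "\<dots> = (if n \<le> p then (\<Sum>r\<le>n. op_apply (fps_nth \<Phi> r) (fps_nth F (n - r))) else 0)"
  proof (cases "n \<le> p")
    case True
    then have "(\<Sum>r\<le>p. if r \<le> n \<and> n \<le> p then op_apply (fps_nth \<Phi> r) (fps_nth F (n - r)) else 0)
        = (\<Sum>r\<le>n. if r \<le> n \<and> n \<le> p then op_apply (fps_nth \<Phi> r) (fps_nth F (n - r)) else 0)"
      by (intro sum.mono_neutral_right) auto
    with True show ?thesis by simp
  qed simp
  also have "\<dots> = fps_nth (fps_cutoff (Suc p) (series_apply \<Phi> F)) n"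
    by (simp add: series_apply_nth less_Suc_eq_le)
  finally show "fps_nth (fps_cutoff (Suc p) (series_apply \<Phi> F)) n
      = fps_nth (\<Sum>r\<le>p. fps_X ^ r * op_series (fps_nth \<Phi> r) (fps_cutoff (Suc (p - r)) F)) n" ..
qed

lemma fps_cutoff_sum: "fps_cutoff n (\<Sum>x\<in>A. f x) = (\<Sum>x\<in>A. fps_cutoff n (f x))"
  by (simp add: fps_eq_iff fps_sum_nth)

text \<open>Both systems can be recovered from each other at order \<open>p\<close> since the matrix of operators relating
  them is, at order zero, an invertible constant diagonal matrix: the remaining terms carry a power
  of \<open>\<Delta>x\<close> and thus only involve equations of lower order.\<close>

locale equivalent_systems =
  fixes N :: nat and H :: "nat \<Rightarrow> nat \<Rightarrow> 'd::finite series" and h :: "nat \<Rightarrow> real"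
    and U V :: "nat \<Rightarrow> 'd expr fps"
  assumes U_eq: "i < N \<Longrightarrow> U i = (\<Sum>l<N. series_apply (H i l) (V l))"
    and H_nth_0: "i < N \<Longrightarrow> l < N \<Longrightarrow> fps_nth (H i l) 0 = (if l = i then const_op (h i) else 0)"
    and h_nonzero: "i < N \<Longrightarrow> h i \<noteq> 0"
begin

definition src_U where "src_U p i E \<longleftrightarrow> E = fps_cutoff (Suc p) (U i)"
definition src_V where "src_V p i E \<longleftrightarrow> E = fps_cutoff (Suc p) (V i)"

text \<open>Pairs of an equation \<open>l\<close> and an order \<open>r \<ge> 1\<close>: the
  non-leading terms, whose equations have order \<open>p - r < p\<close>.\<close>

definition index :: "nat \<Rightarrow> (nat \<times> nat) set" where
  "index p = {..<N} \<times> {1..p}"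

lemma cutoff_U:
  assumes "i < N"
  shows "fps_cutoff (Suc p) (U i) = op_series (const_op (h i)) (fps_cutoff (Suc p) (V i))
    + (\<Sum>x\<in>index p. fps_X ^ snd x *
        op_series (fps_nth (H i (fst x)) (snd x)) (fps_cutoff (Suc (p - snd x)) (V (fst x))))"
proof -
  let ?t = "\<lambda>l r. fps_X ^ r * op_series (fps_nth (H i l) r) (fps_cutoff (Suc (p - r)) (V l))"
  have z: "?t l 0 = (if l = i then op_series (const_op (h i)) (fps_cutoff (Suc p) (V i)) else 0)"
    if "l < N" for l
    using H_nth_0[OF assms that] by (auto simp: fps_eq_iff)
  have "fps_cutoff (Suc p) (U i) = (\<Sum>l<N. \<Sum>r\<le>p. ?t l r)"
    using assms by (simp add: U_eq fps_cutoff_sum fps_cutoff_series_apply)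
  also have "\<dots> = (\<Sum>l<N. ?t l 0 + (\<Sum>r=1..p. ?t l r))"
    by (intro sum.cong refl) (simp add: atMost_atLeast0 sum.atLeast_Suc_atMost)
  also have "\<dots> = (\<Sum>l<N. ?t l 0) + (\<Sum>l<N. \<Sum>r=1..p. ?t l r)"
    by (rule sum.distrib)
  also have "(\<Sum>l<N. ?t l 0) = op_series (const_op (h i)) (fps_cutoff (Suc p) (V i))"
    using assms z by simp
  also have "(\<Sum>l<N. \<Sum>r=1..p. ?t l r) = (\<Sum>x\<in>index p. ?t (fst x) (snd x))"
    by (simp add: index_def sum.cartesian_product case_prod_unfold)
  finally show ?thesis .
qed

lemma obtained_U_from_V:
  assumes "i < N"
  shows "obtained N src_V p i (fps_cutoff (Suc p) (U i))"
proof -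
  have "obtained N src_V p l (fps_cutoff (Suc p) (V l))" if "l < N" for p l
    using that by (intro obtained.truncate) (auto simp: src_V_def)
  with assms show ?thesis
    unfolding cutoff_U[OF assms]
    by (intro obtained_add_sum[where j = fst] obtained_scale h_nonzero) (simp_all add: index_def mem_Times_iff)
qed

text \<open>Forward substitution in the order \<open>p\<close>, for all \<open>i\<close>
  simultaneously, since row \<open>i\<close> may involve every \<open>V l\<close> at lower
  orders.\<close>

lemma obtained_V_from_U:
  assumes "i < N"
  shows "obtained N src_U p i (fps_cutoff (Suc p) (V i))"
  using assms
proof (induction p arbitrary: i rule: less_induct)
  case (less p)
  \<comment> \<open>Cancelling the lower-order terms in \<open>cutoff_U\<close> leaves
    \<open>h i\<close> times the truncated \<open>V i\<close>.\<close>
  define E where "E = fps_cutoff (Suc p) (U i)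
    + (\<Sum>x\<in>index p. fps_X ^ snd x *
        op_series (- fps_nth (H i (fst x)) (snd x)) (fps_cutoff (Suc (p - snd x)) (V (fst x))))"
  have "obtained N src_U p i (fps_cutoff (Suc p) (U i))"
    using less.prems by (intro obtained.truncate) (auto simp: src_U_def)
  then have "obtained N src_U p i E"
    unfolding E_def using less.IH
    by (intro obtained_add_sum[where j = fst]) (simp_all add: index_def mem_Times_iff)
  then have *: "obtained N src_U p i (op_series (const_op (1 / h i)) E)"
    using h_nonzero[OF less.prems] by (intro obtained_scale) auto
  have "E = op_series (const_op (h i)) (fps_cutoff (Suc p) (V i))"
    by (simp add: E_def cutoff_U[OF less.prems] op_series_minus_left sum_negf)
  then have "op_series (const_op (1 / h i)) E
      = op_series (const_op (1 / h i) * const_op (h i)) (fps_cutoff (Suc p) (V i))"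
    by (simp only: op_series_mult)
  also have "const_op (1 / h i) * const_op (h i) = (1 :: 'd diff_op)"
    using h_nonzero[OF less.prems] by (simp add: const_op_def mult_single)
  finally show ?case using * by (simp only: op_series_1)
qed

lemma obtained_iff: "obtained N src_U p i E \<longleftrightarrow> obtained N src_V p i E"
proof
  show "obtained N src_V p i E" if "obtained N src_U p i E"
    using that by (rule obtained_trans) (simp only: src_U_def obtained_U_from_V)
  show "obtained N src_U p i E" if "obtained N src_V p i E"
    using that by (rule obtained_trans) (simp only: src_V_def obtained_V_from_U)
qed

end

section \<open>Matrices over commutative rings\<close>

lemma index_mult_mat_sum:
  assumes "A \<in> carrier_mat n k" "B \<in> carrier_mat k m" "i < n" "j < m"
  shows "(A * B) $$ (i, j) = (\<Sum>l<k. A $$ (i, l) * B $$ (l, j))"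
  using assms by (auto simp: scalar_prod_def atLeast0LessThan intro!: sum.cong)

lemma mat_inv_eqI:
  assumes "A \<in> carrier_mat n n" "B \<in> carrier_mat n n" "A * B = 1\<^sub>m n" "B * A = 1\<^sub>m n"
  shows "mat_inv A = B"
  unfolding mat_inv_def
proof (rule the_equality)
  show "B \<in> carrier_mat (dim_row A) (dim_row A) \<and> inverts_mat A B \<and> inverts_mat B A"
    using assms by (auto simp: inverts_mat_def)
  fix B'
  assume "B' \<in> carrier_mat (dim_row A) (dim_row A) \<and> inverts_mat A B' \<and> inverts_mat B' A"
  then have B': "B' \<in> carrier_mat n n" "A * B' = 1\<^sub>m n"
    using assms(1) by (auto simp: inverts_mat_def)
  then have "B' = (B * A) * B'"
    using assms by simp
  also have "\<dots> = B * (A * B')"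
    using assms B' by (intro assoc_mult_mat) auto
  also have "\<dots> = B"
    using assms B' by simp
  finally show "B' = B" .
qed

lemma invertible_matI:
  assumes "A \<in> carrier_mat n n" "B \<in> carrier_mat n n" "A * B = 1\<^sub>m n" "B * A = 1\<^sub>m n"
  shows "invertible_mat A"
  using assms by (auto simp: invertible_mat_def inverts_mat_def)

lemma invertible_matE:
  assumes "invertible_mat A" "A \<in> carrier_mat n n"
  obtains B where "B \<in> carrier_mat n n" "A * B = 1\<^sub>m n" "B * A = 1\<^sub>m n"
proof -
  from assms obtain B where B: "A * B = 1\<^sub>m n" "B * A = 1\<^sub>m (dim_row B)"
    by (auto simp: invertible_mat_def inverts_mat_def)
  then have "dim_col B = n" "n = dim_row B"
    using assms(2) by (metis index_mult_mat(3) index_one_mat(3), metis carrier_matD(2) index_mult_mat(3) index_one_mat(3))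
  with B that show thesis by auto
qed

text \<open>Cramer's rule over a commutative ring: \<open>u\<close> is the inverse of the
  determinant.\<close>

lemma inverse_of_unit_det:
  assumes "A \<in> carrier_mat n n" "det A * u = 1"
  shows "A * (u \<cdot>\<^sub>m adj_mat A) = 1\<^sub>m n" "(u \<cdot>\<^sub>m adj_mat A) * A = 1\<^sub>m n"
    "u \<cdot>\<^sub>m adj_mat A \<in> carrier_mat n n"
proof -
  note adj = adj_mat[OF assms(1)]
  have "u \<cdot>\<^sub>m (det A \<cdot>\<^sub>m 1\<^sub>m n) = 1\<^sub>m n"
    using assms(2) by (intro eq_matI) (auto simp: mult.commute)
  then show "A * (u \<cdot>\<^sub>m adj_mat A) = 1\<^sub>m n" "(u \<cdot>\<^sub>m adj_mat A) * A = 1\<^sub>m n"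
    using assms(1) adj by (simp_all add: mult_smult_distrib mult_smult_assoc_mat)
  show "u \<cdot>\<^sub>m adj_mat A \<in> carrier_mat n n"
    using adj by simp
qed

lemma inverse_of_product:
  assumes "A \<in> carrier_mat n n" "A' \<in> carrier_mat n n" "B \<in> carrier_mat n n" "B' \<in> carrier_mat n n"
    and "A * A' = 1\<^sub>m n" "B * B' = 1\<^sub>m n"
  shows "(A * B) * (B' * A') = (1\<^sub>m n :: 'a::comm_ring_1 mat)"
proof -
  have "(A * B) * (B' * A') = A * ((B * B') * A')"
    using assms(1-4) by (simp add: assoc_mult_mat[of _ n n _ n _ n])
  also have "\<dots> = 1\<^sub>m n"
    using assms by simp
  finally show ?thesis .
qed

lemma det_mat_diag: "det (mat_diag n d) = (\<Prod>i<n. d i :: 'a::comm_ring_1)"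
proof -
  have "det (mat_diag n d) = prod_list (diag_mat (mat_diag n d))"
    by (rule det_upper_triangular[of _ n]) (auto simp: mat_diag_def)
  also have "diag_mat (mat_diag n d) = map d [0..<n]"
    by (auto simp: diag_mat_def mat_diag_def)
  also have "prod_list (map d [0..<n]) = (\<Prod>i<n. d i)"
    by (simp add: prod.distinct_set_conv_list[symmetric] atLeast0LessThan)
  finally show ?thesis .
qed

context comm_ring_hom
begin

text \<open>Entries of the adjugate are signed minors, and ring homomorphisms commute with
  determinants.\<close>

lemma hom_adj_mat:
  assumes "A \<in> carrier_mat n n"
  shows "map_mat hom (adj_mat A) = adj_mat (map_mat hom A)"
proof -
  have "map_mat hom (mat_delete A j i) = mat_delete (map_mat hom A) j i" if "i < n" "j < n" for i j
    using assms that by (intro eq_matI) (auto simp: mat_delete_def)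
  then show ?thesis
    using assms by (intro eq_matI) (simp_all add: adj_mat_def cofactor_def hom_distribs flip: hom_det)
qed

lemma hom_mat_diag: "map_mat hom (mat_diag n d) = mat_diag n (\<lambda>i. hom (d i))"
  by (rule eq_matI) (auto simp: mat_diag_def)

lemma hom_minus_mat:
  assumes "A \<in> carrier_mat n m" "B \<in> carrier_mat n m"
  shows "map_mat hom (A - B) = map_mat hom A - map_mat hom B"
  using assms by (intro eq_matI) (auto simp: hom_minus)

end

lemma fps_dvd_1I:
  fixes F :: "'a::comm_ring_1 fps"
  assumes "fps_nth F 0 * y = 1"
  shows "F dvd 1"
  using fps_right_inverse[OF assms] by (metis dvd_triv_left)

text \<open>Each factor raises the order in dx by at least one.\<close>

lemma fps_nth_pow_mat:
  fixes Y :: "'a::comm_ring_1 fps mat"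
  assumes Y: "Y \<in> carrier_mat q q" "\<And>i j. i < q \<Longrightarrow> j < q \<Longrightarrow> fps_nth (Y $$ (i, j)) 0 = 0"
    and "i < q" "j < q" "n < r"
  shows "fps_nth ((Y ^\<^sub>m r) $$ (i, j)) n = 0"
  using assms(3-5)
proof (induction r arbitrary: i j n)
  case (Suc r)
  have "fps_nth ((Y ^\<^sub>m r) $$ (i, l) * Y $$ (l, j)) n = 0" if "l < q" for l
    unfolding fps_mult_nth
  proof (rule sum.neutral, rule ballI)
    fix m assume "m \<in> {0..n}"
    \<comment> \<open>As \<open>n \<le> r\<close>, either the left factor is taken below order
      \<open>r\<close>, or \<open>m = n = r\<close> and the right factor is taken at order
      zero.\<close>
    then consider "m < r" | "n - m = 0" using Suc.prems(3) by force
    then show "fps_nth ((Y ^\<^sub>m r) $$ (i, l)) m * fps_nth (Y $$ (l, j)) (n - m) = 0"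
      using Suc.IH[of i l m] Y(2)[of l j] Suc.prems(1,2) that by cases simp_all
  qed
  then show ?case
    using Suc.prems Y(1)
    by (simp add: index_mult_mat_sum[OF pow_carrier_mat[OF Y(1)] Y(1)] fps_sum_nth del: index_mult_mat)
qed simp

section \<open>The action of matrices\<close>

lemma mat_apply_mult:
  assumes "A \<in> carrier_mat n k" "B \<in> carrier_mat k m" "i < n"
  shows "mat_apply (A * B) v i = mat_apply A (mat_apply B v) i"
proof -
  have "mat_apply (A * B) v i = (\<Sum>j<m. \<Sum>l<k. series_apply (A $$ (i, l)) (series_apply (B $$ (l, j)) (v j)))"
    using assms by (simp add: mat_apply_def index_mult_mat_sum[OF assms(1,2)] series_apply_sum_left series_apply_mult del: index_mult_mat(1))
  also have "\<dots> = mat_apply A (mat_apply B v) i"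
    using assms by (subst sum.swap) (simp add: mat_apply_def series_apply_sum_right)
  finally show ?thesis .
qed

lemma mat_apply_one:
  assumes "i < n"
  shows "mat_apply (1\<^sub>m n) v i = v i"
proof -
  have "mat_apply (1\<^sub>m n) v i = (\<Sum>j<n. if j = i then v j else 0)"
    using assms unfolding mat_apply_def by (intro sum.cong) auto
  then show ?thesis using assms by simp
qed

lemma mat_apply_smult:
  assumes "A \<in> carrier_mat n m" "i < n"
  shows "mat_apply (c \<cdot>\<^sub>m A) v i = series_apply c (mat_apply A v i)"
  using assms by (simp add: mat_apply_def series_apply_mult series_apply_sum_right)

lemma mat_apply_minus_left:
  assumes "A \<in> carrier_mat n m" "B \<in> carrier_mat n m" "i < n"
  shows "mat_apply (A - B) v i = mat_apply A v i - mat_apply B v i"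
  using assms by (simp add: mat_apply_def series_apply_diff_left sum_subtractf)

lemma mat_apply_minus_right:
  "mat_apply A (\<lambda>j. v j - w j) i = mat_apply A v i - mat_apply A w i"
  by (simp add: mat_apply_def series_apply_diff_right sum_subtractf)

lemma series_apply_nth_cong:
  assumes "\<And>r. r \<le> n \<Longrightarrow> fps_nth \<Phi> r = fps_nth \<Psi> r"
  shows "fps_nth (series_apply \<Phi> F) n = fps_nth (series_apply \<Psi> F) n"
  using assms by (simp add: series_apply_nth)

section \<open>Lattice Boltzmann schemes\<close>

locale lbm_scheme =
  fixes L :: "'d::finite lbm" and \<tau> :: "real fps"
  assumes scheme: "lattice_boltzmann L" and relax_inv: "invertible_mat (relax_mat L)"
begin

abbreviation "q \<equiv> nmom L"
abbreviation "N \<equiv> ncons L"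
abbreviation "T \<equiv> ser_T L"
abbreviation "S \<equiv> ser_S L"
abbreviation "P \<equiv> char_mat L \<tau>"
abbreviation "X \<equiv> maxwell_mat L \<tau>"

interpretation const_op: comm_ring_hom const_op by (rule comm_ring_hom_const_op)
interpretation const_series: comm_ring_hom const_series by (rule comm_ring_hom_const_series)
interpretation asym: comm_ring_hom "asym \<tau>" by (rule comm_ring_hom_asym)
interpretation nth_0: comm_ring_hom "\<lambda>F :: 'd series. fps_nth F 0" by (rule comm_ring_hom_fps_nth_0)

lemma N_bounds: "0 < N" "N < q"
  using scheme by (auto simp: lattice_boltzmann_def)

lemma mom_mat_carrier: "mom_mat L \<in> carrier_mat q q"
  using scheme by (simp add: lattice_boltzmann_def)

lemma mom_mat_inverse:
  "mat_inv (mom_mat L) \<in> carrier_mat q q"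
  "mom_mat L * mat_inv (mom_mat L) = 1\<^sub>m q" "mat_inv (mom_mat L) * mom_mat L = 1\<^sub>m q"
proof -
  have "invertible_mat (mom_mat L)"
    using scheme by (simp add: lattice_boltzmann_def)
  then obtain B where B: "B \<in> carrier_mat q q" "mom_mat L * B = 1\<^sub>m q" "B * mom_mat L = 1\<^sub>m q"
    using mom_mat_carrier by (rule invertible_matE)
  moreover have "mat_inv (mom_mat L) = B"
    using mom_mat_carrier B by (rule mat_inv_eqI)
  ultimately show "mat_inv (mom_mat L) \<in> carrier_mat q q"
    "mom_mat L * mat_inv (mom_mat L) = 1\<^sub>m q" "mat_inv (mom_mat L) * mom_mat L = 1\<^sub>m q"
    by simp_all
qed

text \<open>Rates of conserved moments carry no sign condition, so invertibility of
  \<open>relax_mat L\<close> is used: its product with an inverse has diagonal entry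
  \<open>relax L j\<close> times a number, which must be 1.\<close>

lemma relax_nonzero: "j < q \<Longrightarrow> relax L j \<noteq> 0"
proof -
  assume j: "j < q"
  obtain B where B: "B \<in> carrier_mat q q" "relax_mat L * B = 1\<^sub>m q"
    using relax_inv by (rule invertible_matE) (auto simp: relax_mat_def)
  have "(relax_mat L * B) $$ (j, j) = relax L j * B $$ (j, j)"
    using j B(1) by (simp add: relax_mat_def mat_diag_mult_left[OF B(1)])
  then show ?thesis using B(2) j by auto
qed

lemma det_relax_mat: "det (relax_mat L) = (\<Prod>i<q. relax L i)"
  by (simp add: relax_mat_def det_mat_diag)

lemma relax_mat_inverse:
  "relax_mat L * mat_diag q (\<lambda>j. 1 / relax L j) = 1\<^sub>m q"
  "mat_diag q (\<lambda>j. 1 / relax L j) * relax_mat L = 1\<^sub>m q"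
proof -
  have "mat_diag q (\<lambda>j. relax L j * (1 / relax L j)) = 1\<^sub>m q"
    using relax_nonzero by (intro eq_matI) (auto simp: mat_diag_def)
  then show "relax_mat L * mat_diag q (\<lambda>j. 1 / relax L j) = 1\<^sub>m q"
    "mat_diag q (\<lambda>j. 1 / relax L j) * relax_mat L = 1\<^sub>m q"
    unfolding relax_mat_def mat_diag_diag by (simp_all add: mult.commute)
qed

lemma mat_inv_relax_mat: "mat_inv (relax_mat L) = mat_diag q (\<lambda>j. 1 / relax L j)"
  by (rule mat_inv_eqI[OF _ _ relax_mat_inverse]) (simp_all add: relax_mat_def)

subsection \<open>Inverses of the matrices of the scheme\<close>

lemma conj_diag_carrier [simp]: "conj_diag e L f \<in> carrier_mat q q"
  unfolding conj_diag_def using mom_mat_carrier mom_mat_inverse(1)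
  by (intro mult_carrier_mat[of _ _ q]) auto

lemma conj_diag_mult:
  assumes "comm_ring_hom e"
  shows "conj_diag e L f * conj_diag e L g = conj_diag e L (\<lambda>j. f j * g j)"
proof -
  interpret e: comm_ring_hom e by (rule assms)
  let ?M = "map_mat e (mom_mat L)" and ?W = "map_mat e (mat_inv (mom_mat L))"
  have M: "?M \<in> carrier_mat q q" "?W \<in> carrier_mat q q"
    using mom_mat_carrier mom_mat_inverse(1) by auto
  have "?W * ?M = 1\<^sub>m q"
    using e.mat_hom_mult[OF mom_mat_inverse(1) mom_mat_carrier] mom_mat_inverse(3) e.mat_hom_one
    by metis
  then have "?W * (?M * Z) = Z" if "Z \<in> carrier_mat q q" for Z
    using M that by (simp flip: assoc_mult_mat[of ?W q q ?M q Z q])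
  then have "(?M * mat_diag q f * ?W) * (?M * mat_diag q g * ?W)
      = ?M * (mat_diag q f * mat_diag q g) * ?W"
    using M by (simp add: assoc_mult_mat[of _ q q _ q _ q] mult_carrier_mat[of _ q q _ q] del: mat_diag_diag)
  then show ?thesis by (simp add: conj_diag_def)
qed

lemma conj_diag_one:
  assumes "comm_ring_hom e"
  shows "conj_diag e L (\<lambda>_. 1) = 1\<^sub>m q"
proof -
  interpret e: comm_ring_hom e by (rule assms)
  have "map_mat e (mom_mat L) * map_mat e (mat_inv (mom_mat L)) = 1\<^sub>m q"
    using e.mat_hom_mult[OF mom_mat_carrier mom_mat_inverse(1)] mom_mat_inverse(2) e.mat_hom_one
    by metis
  then show ?thesis using mom_mat_carrier by (simp add: conj_diag_def)
qed

lemma map_conj_diag: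
  assumes "comm_ring_hom h"
  shows "map_mat h (conj_diag e L f) = conj_diag (\<lambda>c. h (e c)) L (\<lambda>j. h (f j))"
proof -
  interpret h: comm_ring_hom h by (rule assms)
  have "map_mat e (mom_mat L) \<in> carrier_mat q q" "map_mat e (mat_inv (mom_mat L)) \<in> carrier_mat q q"
    using mom_mat_carrier mom_mat_inverse(1) by auto
  moreover have "map_mat h (map_mat e A) = map_mat (\<lambda>c. h (e c)) A" for A
    by (rule eq_matI) auto
  ultimately show ?thesis
    by (simp add: conj_diag_def h.mat_hom_mult[of _ q q _ q] h.hom_mat_diag mult_carrier_mat[of _ q q _ q])
qed

lemma carriers [simp]:
  "T \<in> carrier_mat q q" "ser_Tbar L \<in> carrier_mat q q" "S \<in> carrier_mat q q"
  "ser_S_inv L \<in> carrier_mat q q" "ser_A L \<in> carrier_mat q q" "ser_B L \<in> carrier_mat q q"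
  "zetaI L \<tau> \<in> carrier_mat q q" "P \<in> carrier_mat q q" "X \<in> carrier_mat q q"
  "relax_mat L \<in> carrier_mat q q"
proof -
  show T: "T \<in> carrier_mat q q" "ser_Tbar L \<in> carrier_mat q q"
    by (simp_all add: ser_T_def ser_Tbar_def)
  show S: "S \<in> carrier_mat q q" "ser_S_inv L \<in> carrier_mat q q" "relax_mat L \<in> carrier_mat q q"
    by (simp_all add: ser_S_def ser_S_inv_def mat_inv_relax_mat) (simp_all add: relax_mat_def)
  show A: "ser_A L \<in> carrier_mat q q" "ser_B L \<in> carrier_mat q q"
    unfolding ser_A_def ser_B_def using T S by (auto intro!: mult_carrier_mat[of _ q q])
  show z: "zetaI L \<tau> \<in> carrier_mat q q"
    by (simp add: zetaI_def)
  show "P \<in> carrier_mat q q"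
    unfolding char_mat_def using A by (intro minus_carrier_mat)
  show "X \<in> carrier_mat q q"
    unfolding maxwell_mat_def using T S by (auto intro!: mult_carrier_mat[of _ q q])
qed

lemma Tbar_T: "ser_Tbar L * T = 1\<^sub>m q" "T * ser_Tbar L = 1\<^sub>m q"
  unfolding ser_T_def ser_Tbar_def
  by (simp_all add: conj_diag_mult[OF comm_ring_hom_const_series] shift_series_inverse
      shift_series_inverse[unfolded mult.commute[of "shift_series 1 _"]]
      conj_diag_one[OF comm_ring_hom_const_series])

lemma S_inv_S: "ser_S_inv L * S = 1\<^sub>m q" "S * ser_S_inv L = 1\<^sub>m q"
proof -
  have "mat_inv (relax_mat L) * relax_mat L = 1\<^sub>m q" "relax_mat L * mat_inv (relax_mat L) = 1\<^sub>m q"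
    by (simp_all add: mat_inv_relax_mat relax_mat_inverse)
  moreover have "mat_inv (relax_mat L) \<in> carrier_mat q q"
    by (simp add: mat_inv_relax_mat)
  ultimately show "ser_S_inv L * S = 1\<^sub>m q" "S * ser_S_inv L = 1\<^sub>m q"
    unfolding ser_S_def ser_S_inv_def
    using carriers(10) const_series.mat_hom_mult[of _ q q _ q] const_series.mat_hom_one by metis+
qed

section \<open>Order-zero terms and inversion of the matrix \<open>P\<close>\<close>

lemma T_nth_0: "map_mat (\<lambda>F. fps_nth F 0) T = 1\<^sub>m q"
  "map_mat (\<lambda>F. fps_nth F 0) (ser_Tbar L) = 1\<^sub>m q"
  using conj_diag_one[OF comm_ring_hom_const_op]
  by (simp_all add: ser_T_def ser_Tbar_def map_conj_diag[OF comm_ring_hom_fps_nth_0] const_series_def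
      shift_series_nth_0)

lemma I_minus_S_carrier [simp]: "1\<^sub>m q - S \<in> carrier_mat q q"
  by (rule minus_carrier_mat) simp

text \<open>\<open>T\<close> is the identity at order zero. The vanishing off-diagonal terms later
  make the coupling between conserved moments O(dx).\<close>

lemma A_nth_0:
  assumes "k < q" "l < q"
  shows "fps_nth (ser_A L $$ (k, l)) 0 = (if k = l then 1 - const_op (relax L k) else 0)"
proof -
  have "map_mat (\<lambda>F. fps_nth F 0) (ser_A L) = map_mat (\<lambda>F. fps_nth F 0) (1\<^sub>m q - S)"
    unfolding ser_A_def
    by (subst nth_0.mat_hom_mult[of _ q q _ q]) (simp_all add: T_nth_0 left_mult_one_mat[of _ q q])
  then have "fps_nth (ser_A L $$ (k, l)) 0 = fps_nth ((1\<^sub>m q - S) $$ (k, l)) 0"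
    using assms carriers(3,5) by (metis (no_types, lifting) carrier_matD index_map_mat(1) index_minus_mat(2,3))
  then show ?thesis
    using assms by (simp add: ser_S_def relax_mat_def mat_diag_def const_series_def)
qed

lemma P_nth_0: "map_mat (\<lambda>F. fps_nth F 0) P = map_mat const_op (relax_mat L)"
  by (rule eq_matI)
    (auto simp: char_mat_def zetaI_def A_nth_0 zeta_nth_0 relax_mat_def mat_diag_def
      carrier_matD[OF carriers(5)] carrier_matD[OF carriers(8), unfolded char_mat_def zetaI_def])

lemma det_P_nth_0: "fps_nth (det P) 0 = const_op (det (relax_mat L))"
  using nth_0.hom_det[of P] P_nth_0 const_op.hom_det[of "relax_mat L"] by simp

lemma det_P_unit: "det P dvd 1"
proof (rule fps_dvd_1I)
  have "det (relax_mat L) \<noteq> 0"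
    using relax_nonzero by (simp add: det_relax_mat)
  then show "fps_nth (det P) 0 * const_op (1 / det (relax_mat L)) = 1"
    unfolding det_P_nth_0 const_op_hom(4)[symmetric] by (simp add: const_op_hom)
qed

lemma P_inverse:
  "mat_inv P \<in> carrier_mat q q" "P * mat_inv P = 1\<^sub>m q" "mat_inv P * P = 1\<^sub>m q"
proof -
  obtain u where "1 = det P * u"
    using det_P_unit by (rule dvdE)
  note u = inverse_of_unit_det[OF carriers(8) this[symmetric]]
  have "mat_inv P = u \<cdot>\<^sub>m adj_mat P"
    by (rule mat_inv_eqI[OF carriers(8) u(3,1,2)])
  with u show "mat_inv P \<in> carrier_mat q q" "P * mat_inv P = 1\<^sub>m q" "mat_inv P * P = 1\<^sub>m q"
    by (simp_all only:)
qed

text \<open>The matrix giving the limit \<open>R m\<^sup>e\<^sup>q\<close> of the Maxwell iteration.\<close>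

definition R where "R = mat_inv P * (T * S)"

lemma R_carrier [simp]: "R \<in> carrier_mat q q"
  unfolding R_def by (rule mult_carrier_mat[OF P_inverse(1) mult_carrier_mat[OF carriers(1,3)]])

lemma P_R: "P * R = ser_B L"
proof -
  have "P * R = (P * mat_inv P) * (T * S)"
    unfolding R_def using P_inverse(1) carriers(1,3,8)
    by (intro assoc_mult_mat[symmetric, of _ q q _ q _ q] mult_carrier_mat[of _ q q]) 
  then show ?thesis
    using mult_carrier_mat[OF carriers(1,3)] by (simp add: P_inverse(2) ser_B_def left_mult_one_mat[of _ q q])
qed

text \<open>\<open>ser_Tbar L\<close> cancels \<open>T\<close> inside A, leaving zeta Tbar - I + S;
  the inverse of \<open>S\<close> then turns the last summand into the identity.\<close>

lemma Q_eq: "ser_S_inv L * (ser_Tbar L * P) = 1\<^sub>m q + X"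
proof -
  let ?Tb = "ser_Tbar L" and ?W = "ser_S_inv L"
  note c = I_minus_S_carrier
  have "?Tb * P = ?Tb * zetaI L \<tau> - ?Tb * (T * (1\<^sub>m q - S))"
    unfolding char_mat_def ser_A_def using carriers c
    by (intro mult_minus_distrib_mat[of _ q q _ q]) (auto intro!: mult_carrier_mat[of _ q q])
  also have "?Tb * (T * (1\<^sub>m q - S)) = (?Tb * T) * (1\<^sub>m q - S)"
    using carriers(1,2) c by (intro assoc_mult_mat[symmetric])
  also have "\<dots> = 1\<^sub>m q - S"
    using c by (simp add: Tbar_T left_mult_one_mat[of _ q q])
  also have "?Tb * zetaI L \<tau> = zeta \<tau> \<cdot>\<^sub>m ?Tb"
    by (simp add: zetaI_def mult_smult_distrib[of _ q q _ q] right_mult_one_mat[of _ q q])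
  also have "zeta \<tau> \<cdot>\<^sub>m ?Tb - (1\<^sub>m q - S) = (zeta \<tau> \<cdot>\<^sub>m ?Tb - 1\<^sub>m q) + S"
    by (rule eq_matI) (auto simp: carrier_matD[OF carriers(2)] carrier_matD[OF carriers(3)])
  finally have "?W * (?Tb * P) = ?W * ((zeta \<tau> \<cdot>\<^sub>m ?Tb - 1\<^sub>m q) + S)" by simp
  also have "\<dots> = X + 1\<^sub>m q"
    unfolding maxwell_mat_def by (subst mult_add_distrib_mat[of _ q q _ q]) (simp_all add: S_inv_S minus_carrier_mat)
  also have "\<dots> = 1\<^sub>m q + X"
    by (rule comm_add_mat[of _ q q]) simp_all
  finally show ?thesis .
qed

lemma Q_inverse: "(1\<^sub>m q + X) * R = 1\<^sub>m q" "R * (1\<^sub>m q + X) = 1\<^sub>m q"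
proof -
  let ?V = "ser_S_inv L * ser_Tbar L"
  have c: "?V \<in> carrier_mat q q" "T * S \<in> carrier_mat q q"
    by (auto intro!: mult_carrier_mat[of _ q q])
  have V: "?V * (T * S) = 1\<^sub>m q" "(T * S) * ?V = 1\<^sub>m q"
    using Tbar_T S_inv_S by (intro inverse_of_product; simp)+
  have Q: "1\<^sub>m q + X = ?V * P"
    unfolding Q_eq[symmetric] by (intro assoc_mult_mat[symmetric, of _ q q _ q _ q]) simp_all
  show "(1\<^sub>m q + X) * R = 1\<^sub>m q" "R * (1\<^sub>m q + X) = 1\<^sub>m q"
    unfolding Q R_def by (rule inverse_of_product; simp add: c V P_inverse)+
qed

lemma mat_inv_Q: "mat_inv (1\<^sub>m q + X) = R"
  using Q_inverse by (intro mat_inv_eqI) simp_all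

subsection \<open>The Maxwell iteration\<close>

lemma X_nth_0:
  assumes "i < q" "j < q"
  shows "fps_nth ((- X) $$ (i, j)) 0 = 0"
proof -
  let ?n = "map_mat (\<lambda>F. fps_nth F 0)"
  have c: "zeta \<tau> \<cdot>\<^sub>m ser_Tbar L - 1\<^sub>m q \<in> carrier_mat q q"
    by (intro minus_carrier_mat) simp
  have Tb: "fps_nth (ser_Tbar L $$ (k, l)) 0 = (if k = l then 1 else 0)" if "k < q" "l < q" for k l
    using arg_cong[OF T_nth_0(2), of "\<lambda>A. A $$ (k, l)"] that carrier_matD[OF carriers(2)] by simp
  have "?n (zeta \<tau> \<cdot>\<^sub>m ser_Tbar L - 1\<^sub>m q) = 0\<^sub>m q q"
    by (rule eq_matI) (auto simp: carrier_matD[OF carriers(2)] Tb zeta_nth_0)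
  then have "?n X = 0\<^sub>m q q"
    unfolding maxwell_mat_def
    by (subst nth_0.mat_hom_mult[of _ q q _ q]) (simp_all add: c right_mult_zero_mat[of _ q q])
  then have "?n X $$ (i, j) = 0"
    using assms by simp
  then show ?thesis
    using assms carrier_matD[OF carriers(9)] by simp
qed

lemma minus_X_carrier [simp]: "- X \<in> carrier_mat q q"
  by simp

lemma pow_carrier [simp]: "(- X) ^\<^sub>m r \<in> carrier_mat q q"
  by (rule pow_carrier_mat) simp

text \<open>Fixed-point form of (I + X) R = I; iterating it gives the Neumann sum with an exact
  remainder.\<close>

lemma R_step: "R = 1\<^sub>m q + (- X) * R"
proof (rule eq_matI)
  fix i j assume "i < dim_row (1\<^sub>m q + - X * R)" "j < dim_col (1\<^sub>m q + - X * R)"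
  then have ij: "i < q" "j < q" by (simp_all add: carrier_matD[OF R_carrier] carrier_matD[OF carriers(9)])
  have "1\<^sub>m q = (1\<^sub>m q + X) * R"
    by (simp add: Q_inverse)
  also have "\<dots> = R + X * R"
    by (subst add_mult_distrib_mat[of _ q q _ _ q]) (simp_all add: left_mult_one_mat[of _ q q])
  finally have "1\<^sub>m q $$ (i, j) = R $$ (i, j) + (X * R) $$ (i, j)"
    using ij by (simp add: carrier_matD[OF R_carrier] carrier_matD[OF carriers(9)])
  moreover have "(- X * R) $$ (i, j) = - (X * R) $$ (i, j)"
    using ij by (subst uminus_mult_left_mat)
      (simp_all add: carrier_matD[OF R_carrier] carrier_matD[OF carriers(9)])
  ultimately show "R $$ (i, j) = (1\<^sub>m q + - X * R) $$ (i, j)"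
    using ij by (simp add: carrier_matD[OF R_carrier] carrier_matD[OF carriers(9)])
qed (simp_all add: carrier_matD[OF R_carrier] carrier_matD[OF carriers(9)])

lemma R_partial_sum:
  assumes "i < q" "j < q"
  shows "R $$ (i, j) = (\<Sum>r<k. ((- X) ^\<^sub>m r) $$ (i, j)) + ((- X) ^\<^sub>m k * R) $$ (i, j)"
proof (induction k)
  case 0
  then show ?case using assms carrier_matD[OF carriers(9)] by (simp add: left_mult_one_mat[OF R_carrier])
next
  case (Suc k)
  have "(- X) ^\<^sub>m k * R = (- X) ^\<^sub>m k * (1\<^sub>m q + (- X) * R)"
    using R_step by simp
  also have "\<dots> = (- X) ^\<^sub>m k * 1\<^sub>m q + (- X) ^\<^sub>m k * ((- X) * R)"
    by (rule mult_add_distrib_mat[of _ q q _ q]) (auto intro: mult_carrier_mat[of _ q q])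
  also have "\<dots> = (- X) ^\<^sub>m k + (- X) ^\<^sub>m Suc k * R"
    by (simp add: right_mult_one_mat[OF pow_carrier] assoc_mult_mat[of _ q q _ q _ q])
  finally have "((- X) ^\<^sub>m k * R) $$ (i, j) = ((- X) ^\<^sub>m k) $$ (i, j) + ((- X) ^\<^sub>m Suc k * R) $$ (i, j)"
    using assms by (simp add: carrier_matD[OF R_carrier] carrier_matD[OF carriers(9)]
        carrier_matD[OF pow_carrier] del: index_mult_mat(1))
  then show ?case using Suc by simp
qed

text \<open>The remainder \<open>(- X) ^\<^sub>m k * R\<close> starts at order \<open>k\<close>, so
  the first \<open>k\<close> powers fix all orders below \<open>k\<close>.\<close>

lemma R_nth:
  assumes "i < q" "j < q" "n < k"
  shows "fps_nth (\<Sum>r<k. ((- X) ^\<^sub>m r) $$ (i, j)) n = fps_nth (R $$ (i, j)) n"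
proof -
  have "fps_nth (((- X) ^\<^sub>m k * R) $$ (i, j)) n = 0"
    using assms X_nth_0
    by (simp add: index_mult_mat_sum[OF pow_carrier R_carrier] fps_sum_nth fps_mult_nth
        fps_nth_pow_mat[OF minus_X_carrier] del: index_mult_mat)
  then show ?thesis
    using R_partial_sum[OF assms(1,2), of k] by simp
qed

text \<open>Convergence of formal power series means that each coefficient is eventually
  stationary.\<close>

lemma pow_sums_R:
  assumes "i < q" "j < q"
  shows "(\<lambda>r. ((- X) ^\<^sub>m r) $$ (i, j)) sums (R $$ (i, j))"
  unfolding sums_def
  by (intro tendsto_fpsI eventually_mono[OF eventually_gt_at_top]) (rule R_nth[OF assms])

lemma mat_geometric_eq: "mat_geometric (- X) = R"
  using pow_sums_R carrier_matD[OF R_carrier] carrier_matD[OF carriers(9)]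
  by (intro eq_matI) (simp_all add: mat_geometric_def sums_iff)

abbreviation "limit_moment \<equiv> mat_apply R (meq L)"

lemma maxwell_nth:
  assumes "i < q" "n \<le> k"
  shows "fps_nth (maxwell L \<tau> k i) n = fps_nth (limit_moment i) n"
proof -
  have "fps_nth (series_apply (maxwell_op L \<tau> k $$ (i, j)) (meq L j)) n
      = fps_nth (series_apply (R $$ (i, j)) (meq L j)) n" if "j < q" for j
  proof (rule series_apply_nth_cong)
    fix r assume "r \<le> n"
    \<comment> \<open>Step \<open>k\<close> of the iteration sums \<open>Suc k\<close> powers, hence
      is exact through order \<open>k\<close>.\<close>
    then show "fps_nth (maxwell_op L \<tau> k $$ (i, j)) r = fps_nth (R $$ (i, j)) r"
      using assms that R_nth[of i j r "Suc k"] by (simp add: maxwell_op_def lessThan_Suc_atMost)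
  qed
  then show ?thesis
    by (simp add: maxwell_def mat_apply_def fps_sum_nth carrier_matD[OF R_carrier] maxwell_op_def)
qed

lemma maxwell_tendsto:
  assumes "i < q"
  shows "(\<lambda>k. maxwell L \<tau> k i) \<longlonglongrightarrow> limit_moment i"
  by (intro tendsto_fpsI eventually_mono[OF eventually_ge_at_top]) (rule maxwell_nth[OF assms])

lemma lim_maxwell: "i < q \<Longrightarrow> lim (\<lambda>k. maxwell L \<tau> k i) = limit_moment i"
  using maxwell_tendsto by (rule limI)

text \<open>Since B = P R, the adjugate cancels \<open>P\<close> up to the scalar
  \<open>det P\<close>.\<close>

lemma adj_apply:
  assumes "i < q"
  shows "mat_apply (adj_mat P * ser_B L) (meq L) i = series_apply (det P) (limit_moment i)"
proof -
  note adj = adj_mat[OF carriers(8)]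
  have "adj_mat P * ser_B L = (adj_mat P * P) * R"
    unfolding P_R[symmetric] using adj(1) by (intro assoc_mult_mat[symmetric, of _ q q _ q _ q]) simp_all
  also have "\<dots> = det P \<cdot>\<^sub>m R"
    by (simp add: adj(3) mult_smult_assoc_mat[of _ q q _ q] left_mult_one_mat[OF R_carrier])
  finally show ?thesis
    using assms by (simp add: mat_apply_smult[OF R_carrier])
qed

subsection \<open>The expansion of the Finite Difference schemes\<close>

abbreviation "kept i k \<equiv> k = i \<or> N \<le> k"
abbreviation "fd_series i \<equiv> map_mat (asym \<tau>) (fd_mat L i)"
abbreviation "diamond_series i \<equiv> map_mat (asym \<tau>) (disc_A_diamond L i)"

lemma disc_carriers [simp]:
  "disc_T L \<in> carrier_mat q q" "disc_A L \<in> carrier_mat q q" "disc_B L \<in> carrier_mat q q"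
  "disc_A_keep L i \<in> carrier_mat q q" "disc_A_diamond L i \<in> carrier_mat q q"
  "fd_mat L i \<in> carrier_mat q q"
proof -
  show T: "disc_T L \<in> carrier_mat q q"
    by (simp add: disc_T_def)
  show A: "disc_A L \<in> carrier_mat q q"
    unfolding disc_A_def by (intro mult_carrier_mat[OF T] minus_carrier_mat) simp
  show "disc_B L \<in> carrier_mat q q"
    unfolding disc_B_def by (intro mult_carrier_mat[OF T]) simp
  show K: "disc_A_keep L i \<in> carrier_mat q q"
    by (simp add: disc_A_keep_def Let_def)
  then show "disc_A_diamond L i \<in> carrier_mat q q" "fd_mat L i \<in> carrier_mat q q"
    unfolding disc_A_diamond_def fd_mat_def by (auto intro: minus_carrier_mat)
qed

lemma map_disc_T: "map_mat (asym \<tau>) (disc_T L) = T"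
  by (simp add: disc_T_def ser_T_def map_conj_diag[OF comm_ring_hom_asym] asym_const asym_space_shift)

lemma map_disc_S: "map_mat (asym \<tau>) (map_mat const_op (relax_mat L)) = S"
  by (rule eq_matI) (auto simp: ser_S_def asym_const)

lemma map_disc_A: "map_mat (asym \<tau>) (disc_A L) = ser_A L"
proof -
  have c: "1\<^sub>m q - map_mat const_op (relax_mat L) \<in> carrier_mat q q"
    by (intro minus_carrier_mat) simp
  show ?thesis
    unfolding disc_A_def ser_A_def asym.mat_hom_mult[OF disc_carriers(1) c] map_disc_T
    by (subst asym.hom_minus_mat[of _ q q]) (simp_all add: map_disc_S asym.mat_hom_one)
qed

lemma map_disc_B: "map_mat (asym \<tau>) (disc_B L) = ser_B L"
  unfolding disc_B_def ser_B_def
  by (subst asym.mat_hom_mult[of _ q q _ q]) (simp_all add: map_disc_S map_disc_T)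

lemma asym_disc_A: "k < q \<Longrightarrow> l < q \<Longrightarrow> asym \<tau> (disc_A L $$ (k, l)) = ser_A L $$ (k, l)"
  unfolding map_disc_A[symmetric] by (simp add: carrier_matD[OF disc_carriers(2)])

lemma diamond_series_index:
  assumes "i < q" "k < q" "l < q"
  shows "diamond_series i $$ (k, l) = (if kept i k \<and> kept i l then 0 else ser_A L $$ (k, l))"
  using assms by (simp add: disc_A_diamond_def disc_A_keep_def Let_def
      carrier_matD[OF disc_carriers(2)] asym_disc_A asym_0)

lemma fd_series_index:
  assumes "i < q" "k < q" "l < q"
  shows "fd_series i $$ (k, l) = (if k = l then zeta \<tau> else 0)
    - (if kept i k \<and> kept i l then ser_A L $$ (k, l) else 0)"
  using assms by (simp add: fd_mat_def disc_A_keep_def Let_def asym_disc_A asym_0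
      asym.hom_minus asym_time_shift)

lemma fd_series_minus_diamond:
  assumes "i < q"
  shows "fd_series i - diamond_series i = P"
proof (rule eq_matI)
  fix k l assume "k < dim_row P" "l < dim_col P"
  then have kl: "k < q" "l < q" by (simp_all add: carrier_matD[OF carriers(8)])
  then show "(fd_series i - diamond_series i) $$ (k, l) = P $$ (k, l)"
    using assms carrier_matD[OF carriers(5)] carrier_matD[OF disc_carriers(5)]
      fd_series_index[OF assms kl] diamond_series_index[OF assms kl]
    by (simp add: char_mat_def zetaI_def)
qed (simp_all add: carrier_matD[OF carriers(8)] carrier_matD[OF disc_carriers(5)])

text \<open>At order zero the matrix is diagonal: a removed index contributes zeta = 1, a kept one 1
  - (1 - s) = s.\<close>

lemma det_fd_series_nth_0:
  assumes "i < q"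
  shows "fps_nth (det (fd_series i)) 0 = const_op (\<Prod>k<q. if kept i k then relax L k else 1)"
proof -
  let ?d = "\<lambda>k. if kept i k then relax L k else 1"
  have "map_mat (\<lambda>F. fps_nth F 0) (fd_series i) = map_mat const_op (mat_diag q ?d)"
  proof (rule eq_matI)
    fix k l assume "k < dim_row (map_mat const_op (mat_diag q ?d))" "l < dim_col (map_mat const_op (mat_diag q ?d))"
    then have kl: "k < q" "l < q" by (simp_all add: mat_diag_def)
    then show "map_mat (\<lambda>F. fps_nth F 0) (fd_series i) $$ (k, l) = map_mat const_op (mat_diag q ?d) $$ (k, l)"
      using fd_series_index[OF assms kl] carrier_matD[OF disc_carriers(6)]
      by (simp add: A_nth_0 zeta_nth_0 mat_diag_def const_op_hom)
  qed (simp_all add: carrier_matD[OF disc_carriers(6)] mat_diag_def)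
  then show ?thesis
    using nth_0.hom_det[of "fd_series i"] const_op.hom_det[of "mat_diag q ?d"] by (simp add: det_mat_diag)
qed

lemma adj_fd_series_carrier [simp]: "adj_mat (fd_series i) \<in> carrier_mat q q"
  by (rule adj_mat) simp

text \<open>Column \<open>j\<close> of \<open>\<zeta> I - A\<^sub>i\<close> is \<open>\<zeta>\<close> times a unit vector when \<open>j\<close> is a removed index, and \<open>\<zeta>\<close> is a
  unit.\<close>

lemma adj_fd_series_index:
  assumes "i < N" "j < N" "j \<noteq> i"
  shows "adj_mat (fd_series i) $$ (i, j) = 0"
proof -
  have ij: "i < q" "j < q" using assms N_bounds by auto
  have c: "fd_series i \<in> carrier_mat q q" by simp
  have "0 = (adj_mat (fd_series i) * fd_series i) $$ (i, j)"
    using assms ij by (simp add: adj_mat(3)[OF c] del: index_mult_mat)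
  also have "\<dots> = (\<Sum>k<q. adj_mat (fd_series i) $$ (i, k) * fd_series i $$ (k, j))"
    using ij by (intro index_mult_mat_sum[of _ q q _ q]) simp_all
  also have "\<dots> = (\<Sum>k<q. if k = j then adj_mat (fd_series i) $$ (i, k) * zeta \<tau> else 0)"
    using assms ij fd_series_index[OF ij(1) _ ij(2)] by (intro sum.cong refl) auto
  also have "\<dots> = adj_mat (fd_series i) $$ (i, j) * zeta \<tau>"
    using ij by simp
  finally have *: "adj_mat (fd_series i) $$ (i, j) * zeta \<tau> = 0" ..
  have "(zeta \<tau> :: 'd series) dvd 1"
    by (rule fps_dvd_1I[of _ 1]) (simp add: zeta_nth_0)
  then obtain u where "1 = zeta \<tau> * (u :: 'd series)"
    by (rule dvdE)
  then have "adj_mat (fd_series i) $$ (i, j) = adj_mat (fd_series i) $$ (i, j) * zeta \<tau> * u"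
    by (simp add: mult.assoc)
  with * show ?thesis by simp
qed

definition coupling :: "nat \<Rightarrow> 'd series mat" where
  "coupling i = adj_mat (fd_series i) * diamond_series i"

lemma coupling_carrier [simp]: "coupling i \<in> carrier_mat q q"
  unfolding coupling_def by (rule mult_carrier_mat[of _ q q]) simp_all

text \<open>Removed rows \<open>k\<close> drop out because the adjugate vanishes there; in a kept
  row the diamond matrix has entries only in removed columns.\<close>

lemma coupling_index:
  assumes "i < N" "l < q"
  shows "coupling i $$ (i, l) =
    (\<Sum>k<q. if kept i k \<and> \<not> kept i l then adj_mat (fd_series i) $$ (i, k) * ser_A L $$ (k, l) else 0)"
proof -
  have i: "i < q" using assms N_bounds by auto
  have "coupling i $$ (i, l) = (\<Sum>k<q. adj_mat (fd_series i) $$ (i, k) * diamond_series i $$ (k, l))"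
    unfolding coupling_def using i assms by (intro index_mult_mat_sum[of _ q q _ q]) simp_all
  also have "\<dots> = (\<Sum>k<q. if kept i k \<and> \<not> kept i l
      then adj_mat (fd_series i) $$ (i, k) * ser_A L $$ (k, l) else 0)"
    using assms adj_fd_series_index[OF assms(1)] diamond_series_index[OF i _ assms(2)]
    by (intro sum.cong refl) auto
  finally show ?thesis .
qed

text \<open>This eliminates the non-conserved moments, and the \<open>i\<close>-th moment itself,
  from the coupling.\<close>

lemma coupling_eq_0: "i < N \<Longrightarrow> l < q \<Longrightarrow> kept i l \<Longrightarrow> coupling i $$ (i, l) = 0"
  by (simp only: coupling_index) simp

text \<open>A kept row and a removed column meet in an off-diagonal entry of A, which is
  O(dx).\<close>

lemma coupling_nth_0:
  assumes "i < N" "l < q"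
  shows "fps_nth (coupling i $$ (i, l)) 0 = 0"
  unfolding coupling_index[OF assms] fps_sum_nth
  using assms by (intro sum.neutral) (auto simp: A_nth_0)

abbreviation "defect j \<equiv> moment j - limit_moment j"

text \<open>Substitute \<open>B m\<^sup>e\<^sup>q = P R m\<^sup>e\<^sup>q\<close> with \<open>P = (\<zeta> I - A\<^sub>i) - A\<^sub>i\<^sup>\<diamond>\<close> into the scheme.\<close>

lemma fd_expansion_eq:
  assumes "i < N"
  shows "fd_expansion L \<tau> i = series_apply (det (fd_series i)) (defect i)
    - (\<Sum>l<N. series_apply (coupling i $$ (i, l)) (defect l))"
proof -
  have i: "i < q" using assms N_bounds by auto
  have c: "fd_series i \<in> carrier_mat q q" "diamond_series i \<in> carrier_mat q q" by simp_all
  note adj = adj_mat[OF c(1)] adj_mat[OF disc_carriers(6)]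
  have "map_mat (asym \<tau>) (adj_mat (fd_mat L i) * disc_B L) = adj_mat (fd_series i) * ser_B L"
    using adj by (simp add: asym.mat_hom_mult[of _ q q _ q] asym.hom_adj_mat[OF disc_carriers(6)] map_disc_B)
  also have "\<dots> = (adj_mat (fd_series i) * P) * R"
    unfolding P_R[symmetric] by (intro assoc_mult_mat[symmetric, of _ q q _ q _ q]) simp_all
  also have "adj_mat (fd_series i) * P = det (fd_series i) \<cdot>\<^sub>m 1\<^sub>m q - coupling i"
    unfolding fd_series_minus_diamond[OF i, symmetric] coupling_def adj(3)[symmetric]
    by (rule mult_minus_distrib_mat[of _ q q _ q]) simp_all
  finally have B: "mat_apply (map_mat (asym \<tau>) (adj_mat (fd_mat L i) * disc_B L)) (meq L) i
      = series_apply (det (fd_series i)) (limit_moment i) - mat_apply (coupling i) limit_moment i"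
    using i by (simp add: mat_apply_mult[of _ q q _ q] mat_apply_minus_left[of _ q q] minus_carrier_mat
        mat_apply_smult[of _ q q] mat_apply_one)
  have G: "map_mat (asym \<tau>) (adj_mat (fd_mat L i) * disc_A_diamond L i) = coupling i"
    using adj by (simp add: coupling_def asym.mat_hom_mult[of _ q q _ q] asym.hom_adj_mat[OF disc_carriers(6)])
  have "fd_expansion L \<tau> i = series_apply (det (fd_series i)) (defect i)
      - mat_apply (coupling i) defect i"
    unfolding fd_expansion_def B G mat_apply_minus_right series_apply_diff_right asym.hom_det[symmetric]
    by simp
  also have "mat_apply (coupling i) defect i = (\<Sum>l<q. series_apply (coupling i $$ (i, l)) (defect l))"
    by (simp add: mat_apply_def carrier_matD[OF coupling_carrier])
  also have "\<dots> = (\<Sum>l<N. series_apply (coupling i $$ (i, l)) (defect l))"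
    using N_bounds coupling_eq_0[OF assms] by (intro sum.mono_neutral_right) auto
  finally show ?thesis .
qed

lemma obtained_fd_iff_maxwell:
  "obtained N (fd_source L \<tau>) p i E \<longleftrightarrow> obtained N (maxwell_source L \<tau>) p i E"
proof -
  \<comment> \<open>The coupling has zero \<open>i\<close>-th entry in row \<open>i\<close>, so
    \<open>H i i\<close> is the determinant itself for conserved \<open>i\<close>.\<close>
  define H where "H i l = (if l = i then det (fd_series i) else 0) - coupling i $$ (i, l)" for i l
  interpret equivalent_systems N H "\<lambda>i. \<Prod>k<q. if kept i k then relax L k else 1"
    "fd_expansion L \<tau>" defect
  proof
    show "fd_expansion L \<tau> i = (\<Sum>l<N. series_apply (H i l) (defect l))" if "i < N" for i
    proof -
      have "(\<Sum>l<N. series_apply (if l = i then det (fd_series i) else 0) (defect l))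
          = (\<Sum>l<N. if l = i then series_apply (det (fd_series i)) (defect l) else 0)"
        by (intro sum.cong refl) simp
      then show ?thesis
        using that by (simp add: H_def fd_expansion_eq series_apply_diff_left sum_subtractf)
    qed
    show "fps_nth (H i l) 0 = (if l = i then const_op (\<Prod>k<q. if kept i k then relax L k else 1) else 0)"
      if "i < N" "l < N" for i l
      using that N_bounds by (simp add: H_def det_fd_series_nth_0 coupling_nth_0 del: asym.hom_det)
    show "(\<Prod>k<q. if kept i k then relax L k else 1) \<noteq> 0" for i
      using relax_nonzero by auto
  qed
  have U: "src_U = fd_source L \<tau>"
    by (simp add: fun_eq_iff src_U_def fd_source_def)
  \<comment> \<open>Every admissible \<open>k \<ge> p\<close> gives the same truncation as the
    limit.\<close>
  have V: "maxwell_source L \<tau> p i E \<longleftrightarrow> src_V p i E" if "i < N" for p i E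
  proof -
    have "fps_cutoff (Suc p) (moment i - maxwell L \<tau> k i) = fps_cutoff (Suc p) (defect i)"
      if "p \<le> k" for k
      using that \<open>i < N\<close> N_bounds maxwell_nth[of i _ k] by (simp add: fps_eq_iff)
    then show ?thesis by (auto simp: src_V_def maxwell_source_def)
  qed
  have "obtained N src_V p i E \<longleftrightarrow> obtained N (maxwell_source L \<tau>) p i E"
    using V by (blast intro: obtained_trans obtained.truncate)
  with obtained_iff show ?thesis by (simp only: U)
qed

text \<open>Both sides select from the obtained equations by the same condition on their
  form.\<close>

lemma modified_equations_eq:
  "fd_modified_equations L \<tau> p i = maxwell_modified_equations L \<tau> p i"
  by (simp add: fd_modified_equations_def maxwell_modified_equations_def modified_equations_def
      obtained_fd_iff_maxwell)

text \<open>With one conserved moment every index is kept, so nothing is split off from A and the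
  scheme matrix is \<open>P\<close> itself.\<close>

lemma fd_expansion_one_conserved:
  assumes "N = 1"
  shows "fd_expansion L \<tau> 0 = series_apply (det P) (defect 0)"
proof -
  have "0 < q" using N_bounds by simp
  have "diamond_series 0 = 0\<^sub>m q q"
    using assms N_bounds diamond_series_index[OF \<open>0 < q\<close>]
    by (intro eq_matI) (auto simp: carrier_matD[OF disc_carriers(5)] simp del: index_map_mat(1))
  moreover have "fd_series 0 - 0\<^sub>m q q = fd_series 0"
    by (rule eq_matI) (auto simp: carrier_matD[OF disc_carriers(6)])
  ultimately have "fd_series 0 = P"
    using fd_series_minus_diamond[OF \<open>0 < q\<close>] by simp
  then show ?thesis
    using assms N_bounds by (simp add: fd_expansion_eq coupling_eq_0)
qed

end

theorem mainTheorem3: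
  fixes L :: "'d::finite lbm" and \<tau> :: "real fps"
  assumes scheme: "lattice_boltzmann L"
    and relax_inv: "invertible_mat (relax_mat L)"
    and scal: "scaling \<tau>"
  shows
    "det (char_mat L \<tau>) dvd 1 \<and> invertible_mat (char_mat L \<tau>) \<and>
     (\<forall>p. \<forall>i<ncons L. fd_modified_equations L \<tau> p i = maxwell_modified_equations L \<tau> p i) \<and>
     (ncons L = 1 \<longrightarrow>
       (let q = nmom L; P = char_mat L \<tau>; X = maxwell_mat L \<tau>;
            P' = zetaI L \<tau> - ser_T L * (1\<^sub>m q - ser_S L);
            Q = ser_S_inv L * (ser_Tbar L * P');
            det_times = series_apply (det P)
        in
        invertible_mat Q \<and> invertible_mat (1\<^sub>m q + X) \<and>
        (\<forall>i<q. \<forall>j<q. summable (\<lambda>r. ((- X) ^\<^sub>m r) $$ (i, j))) \<and>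
        (\<forall>i<q. convergent (\<lambda>k. maxwell L \<tau> k i)) \<and>
        (\<forall>i<q.
           det_times (moment i) - mat_apply (adj_mat P * ser_B L) (meq L) i
             = det_times (moment i - mat_apply (mat_inv P' * (ser_T L * ser_S L)) (meq L) i) \<and>
           det_times (moment i - mat_apply (mat_inv P' * (ser_T L * ser_S L)) (meq L) i)
             = det_times (moment i - mat_apply (mat_inv Q) (meq L) i) \<and>
           det_times (moment i - mat_apply (mat_inv Q) (meq L) i)
             = det_times (moment i - mat_apply (mat_inv (1\<^sub>m q + X)) (meq L) i) \<and>
           det_times (moment i - mat_apply (mat_inv (1\<^sub>m q + X)) (meq L) i)
             = det_times (moment i - mat_apply (mat_geometric (- X)) (meq L) i) \<and>
           det_times (moment i - mat_apply (mat_geometric (- X)) (meq L) i)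
             = det_times (moment i - lim (\<lambda>k. maxwell L \<tau> k i))) \<and>
        fd_expansion L \<tau> 0 = det_times (moment 0 - lim (\<lambda>k. maxwell L \<tau> k 0)) \<and>
        fps_nth (det P) 0 = const_op (det (relax_mat L)) \<and>
        det (relax_mat L) = relax L 0 * (\<Prod>i\<in>{1..<q}. relax L i)))"
proof -
  interpret lbm_scheme L \<tau>
    by standard (rule scheme, rule relax_inv)
  have P': "zetaI L \<tau> - ser_T L * (1\<^sub>m q - ser_S L) = P"
    by (simp add: char_mat_def ser_A_def)
  have R': "mat_inv P * (ser_T L * ser_S L) = R"
    by (simp add: R_def)
  have inv: "invertible_mat (1\<^sub>m q + X)"
    using Q_inverse by (intro invertible_matI[of _ q R]) simp_all
  have summable: "summable (\<lambda>r. ((- X) ^\<^sub>m r) $$ (i, j))" if "i < q" "j < q" for i j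
    using pow_sums_R[OF that] by (rule sums_summable)
  have convergent: "convergent (\<lambda>k. maxwell L \<tau> k i)" if "i < q" for i
    using maxwell_tendsto[OF that] by (rule convergentI)
  have adj: "series_apply (det P) (moment i) - mat_apply (adj_mat P * ser_B L) (meq L) i
      = series_apply (det P) (defect i)" if "i < q" for i
    using that by (simp only: adj_apply series_apply_diff_right)
  have one: "fd_expansion L \<tau> 0 = series_apply (det P) (moment 0 - lim (\<lambda>k. maxwell L \<tau> k 0))"
    if "ncons L = 1"
    using fd_expansion_one_conserved[OF that] N_bounds by (simp add: lim_maxwell)
  have prod: "det (relax_mat L) = relax L 0 * (\<Prod>i\<in>{1..<q}. relax L i)"
    using N_bounds unfolding det_relax_mat lessThan_atLeast0
    by (simp add: prod.atLeast_Suc_lessThan)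
  have "invertible_mat P"
    using P_inverse by (intro invertible_matI[of _ q "mat_inv P"]) simp_all
  \<comment> \<open>After rewriting, the inverses in the chain and the geometric series all become
    \<open>R\<close>; what remains are the first equality, from \<open>adj\<close>, and the last,
    from \<open>lim_maxwell\<close>.\<close>
  then show ?thesis
    unfolding Let_def P' R' Q_eq mat_inv_Q mat_geometric_eq
    using det_P_unit modified_equations_eq inv summable convergent adj one det_P_nth_0 prod lim_maxwell
    by simp
qed

end
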